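(* The function $P\mapsto\mathrm{G}_P(\mathbf{x};q)$ on Dyck paths is the unique function $F:\mathrm{DYCK}\to\Lambda$, $P\mapsto F_P$, satisfying: (i) for all integers $k\ge0$, $F_{\mathtt{n}(\mathtt{n}\mathtt{e})^k\mathtt{e}}=\sum_{\alpha}(q-1)^{k-\ell(\alpha)+1}\mathrm{e}_\alpha(\mathbf{x})$, the sum over all compositions $\alpha$ of $k+1$, where $\ell(\alpha)$ is the number of parts and $\mathrm{e}_\alpha=\prod_i\mathrm{e}_{\alpha_i}$; (ii) $F_{PQ}=F_PF_Q$ for all $P,Q\in\mathrm{DYCK}$; (vi) for every Dyck path $P$ and every point $(x,z)\in\mathbb{Z}^2$ on $P$ with $x+1<z$: if the bounce decomposition of $P$ at $(x,z)$ is $P=U\mathtt{n}\cdot\mathtt{n}V\mathtt{n}\mathtt{e}\cdot\mathtt{e}W$ then $F_{U\mathtt{n}\mathtt{n}V\mathtt{n}\mathtt{e}\mathtt{e}W}=(q+1)F_{U\mathtt{n}\mathtt{n}V\mathtt{e}\mathtt{n}\mathtt{e}W}-qF_{U\mathtt{n}\mathtt{n}V\mathtt{e}\mathtt{e}\mathtt{n}W}$; and if the bounce decomposition of $P$ at $(x,z)$ is $P=U\mathtt{n}\mathtt{e}\cdot\mathtt{n}V\mathtt{n}\mathtt{e}\cdot\mathtt{e}W$ then $F_{U\mathtt{e}\mathtt{n}\mathtt{n}V\mathtt{e}\mathtt{n}\mathtt{e}W}+F_{U\mathtt{n}\mathtt{e}\mathtt{n}V\mathtt{n}\mathtt{e}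\mathtt{e}W}+F_{U\mathtt{n}\mathtt{n}\mathtt{e}V\mathtt{e}\mathtt{e}\mathtt{n}W}=F_{U\mathtt{e}\mathtt{n}\mathtt{n}V\mathtt{n}\mathtt{e}\mathtt{e}W}+F_{U\mathtt{n}\mathtt{e}\mathtt{n}V\mathtt{e}\mathtt{e}\mathtt{n}W}+F_{U\mathtt{n}\mathtt{n}\mathtt{e}V\mathtt{e}\mathtt{n}\mathtt{e}W}$.
   Context: Let $K=\mathbb{Q}(q)$ and $\Lambda$ the algebra of symmetric functions over $K$ in $\mathbf{x}=(x_1,x_2,\dots)$; $\mathrm{e}_k$ are elementary symmetric functions. Steps: $\mathtt{n}=(0,1)$, $\mathtt{e}=(1,0)$. A Dyck path of size $n$ is a lattice path from $(0,0)$ to $(n,n)$ with steps in $\{\mathtt{n},\mathtt{e}\}$ such that every east step is preceded by strictly more north steps than east steps. Paths are words in $\{\mathtt{n},\mathtt{e}\}^*$, $PQ$ is concatenation, $\mathrm{DYCK}$ is the set of all Dyck paths. Bounce path of a Dyck path $P$ (size $n$) at a lattice point $(u_1,u_0)$ on $P$: move south from $(u_1,u_0)$ to $(u_1,u_1)$, then west until first reaching a point $(u_2,u_1)$ of $P$ (for Dyck paths it stops there). The bounce decomposition at $(u_1,u_0)$ is the unique factorisation $P=Us_1\cdot s_2Vs_3\cdot s_4W$ ($s_i$ single steps, $U,V,W$ words) where $Us_1$ is the part of $P$ from $(0,0)$ to $(u_2,u_1)$ and $s_4W$ is the part from $(u_1,u_0)$ to $(n,n)$; dots are only markers, and in a factorisation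 like $U\mathtt{n}\mathtt{e}\cdot\mathtt{n}V\dots$ the letters adjacent to the dots play the roles of $s_1,s_2$ (resp. $s_3,s_4$). For $P$ of size $n$, $\Gamma_P$ is the graph on $[n]$ with an edge $\{x,y\}$, $1\le x<y\le n$, whenever the unit square $[x-1,x]\times[y-1,y]$ lies in the region between $P$ and the line $y=x$. For a map $\kappa:[n]\to\mathbb{Z}_{>0}$, $\mathrm{asc}(\kappa)$ is the number of edges $\{x,y\}$, $x<y$, with $\kappa(x)<\kappa(y)$, and $\mathrm{G}_P(\mathbf{x};q)=\sum_{\kappa:[n]\to\mathbb{Z}_{>0}}q^{\mathrm{asc}(\kappa)}x_{\kappa(1)}\cdots x_{\kappa(n)}$ (the unicellular LLT polynomial). *)

theory Defs
  imports
    "HOL-Analysis.Analysis"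
    "HOL-Library.FuncSet"
    "HOL-Library.Poly_Mapping"
    "HOL-Computational_Algebra.Polynomial"
    "HOL-Computational_Algebra.Fraction_Field"
begin

section \<open>Power series in countably many variables\<close>

text \<open>
  A monomial is a finitely supported exponent function. The index \<open>i :: nat\<close> stands for the
  variable usually written \<open>x\<^sub>i\<^sub>+\<^sub>1\<close>, so the positive integers are replaced by \<open>nat\<close>
  as an isomorphic linear order.
\<close>

type_synonym monomial = "nat \<Rightarrow>\<^sub>0 nat"

typedef 'a mps = "UNIV :: (monomial \<Rightarrow> 'a) set"
  morphisms mps_coeff Abs_mps ..

setup_lifting type_definition_mps

lemma mps_eq_iff: "f = g \<longleftrightarrow> (\<forall>m. mps_coeff f m = mps_coeff g m)"
  by transfer auto

lemma mps_eqI: "(\<And>m. mps_coeff f m = mps_coeff g m) \<Longrightarrow> f = g"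
  by (simp add: mps_eq_iff)

definition splits :: "monomial \<Rightarrow> (monomial \<times> monomial) set" where
  "splits m = {(a, b). a + b = m}"

lemma finite_monomials_below:
  "finite {a :: monomial. \<forall>i. Poly_Mapping.lookup a i \<le> Poly_Mapping.lookup m i}" (is "finite ?A")
proof -
  let ?K = "Poly_Mapping.keys m"
  have "Poly_Mapping.lookup ` ?A \<subseteq>
    {f. \<forall>i. (i \<in> ?K \<longrightarrow> f i \<in> {..\<Sum>j\<in>?K. Poly_Mapping.lookup m j}) \<and> (i \<notin> ?K \<longrightarrow> f i = 0)}"
  proof clarsimp
    fix a i
    assume le: "\<forall>i. Poly_Mapping.lookup a i \<le> Poly_Mapping.lookup m i"
    show "(i \<in> ?K \<longrightarrow> Poly_Mapping.lookup a i \<le> (\<Sum>j\<in>?K. Poly_Mapping.lookup m j)) \<and>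
      (i \<notin> ?K \<longrightarrow> Poly_Mapping.lookup a i = 0)"
    proof (intro conjI impI)
      assume "i \<in> ?K"
      then have "Poly_Mapping.lookup m i \<le> (\<Sum>j\<in>?K. Poly_Mapping.lookup m j)"
        by (intro member_le_sum) auto
      with le show "Poly_Mapping.lookup a i \<le> (\<Sum>j\<in>?K. Poly_Mapping.lookup m j)"
        using order_trans by blast
    next
      assume "i \<notin> ?K"
      then have "Poly_Mapping.lookup m i = 0"
        by (simp add: in_keys_iff)
      with le show "Poly_Mapping.lookup a i = 0"
        by (metis le_zero_eq)
    qed
  qed
  then have "finite (Poly_Mapping.lookup ` ?A)"
    by (rule finite_subset) (rule finite_set_of_finite_funs; simp)
  then show ?thesis
    by (rule finite_imageD) (auto simp: inj_on_def poly_mapping_eqI)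
qed

lemma finite_splits [simp]: "finite (splits m)"
proof (rule finite_subset)
  let ?A = "{a :: monomial. \<forall>i. Poly_Mapping.lookup a i \<le> Poly_Mapping.lookup m i}"
  show "splits m \<subseteq> ?A \<times> ?A"
    by (auto simp: splits_def lookup_add)
  show "finite (?A \<times> ?A)"
    using finite_monomials_below by blast
qed

instantiation mps :: (comm_ring_1) comm_ring_1
begin

lift_definition zero_mps :: "'a mps" is "\<lambda>_. 0" .
lift_definition one_mps :: "'a mps" is "\<lambda>m. if m = 0 then 1 else 0" .
lift_definition plus_mps :: "'a mps \<Rightarrow> 'a mps \<Rightarrow> 'a mps" is "\<lambda>f g m. f m + g m" .
lift_definition uminus_mps :: "'a mps \<Rightarrow> 'a mps" is "\<lambda>f m. - f m" .
lift_definition minus_mps :: "'a mps \<Rightarrow> 'a mps \<Rightarrow> 'a mps" is "\<lambda>f g m. f m - g m" .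
lift_definition times_mps :: "'a mps \<Rightarrow> 'a mps \<Rightarrow> 'a mps" is
  "\<lambda>f g m. \<Sum>(a, b)\<in>splits m. f a * g b" .

instance
proof
  fix f g h :: "'a mps"
  show "f * g = g * f"
  proof transfer
    fix f g :: "monomial \<Rightarrow> 'a"
    have "(\<Sum>(a, b)\<in>splits m. f a * g b) = (\<Sum>(a, b)\<in>splits m. g a * f b)" for m
      by (rule sum.reindex_bij_witness[where i = prod.swap and j = prod.swap])
        (auto simp: splits_def add.commute mult.commute)
    then show "(\<lambda>m. \<Sum>(a, b)\<in>splits m. f a * g b) = (\<lambda>m. \<Sum>(a, b)\<in>splits m. g a * f b)"
      by auto
  qed
  show "f * g * h = f * (g * h)"
  proof transfer
    fix f g h :: "monomial \<Rightarrow> 'a"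
    have "(\<Sum>(a, b)\<in>splits m. (\<Sum>(c, d)\<in>splits a. f c * g d) * h b) =
      (\<Sum>(a, b)\<in>splits m. f a * (\<Sum>(c, d)\<in>splits b. g c * h d))" for m
    proof -
      have "(\<Sum>(a, b)\<in>splits m. (\<Sum>(c, d)\<in>splits a. f c * g d) * h b) =
        (\<Sum>p\<in>splits m. \<Sum>r\<in>splits (fst p). f (fst r) * g (snd r) * h (snd p))"
        by (simp add: case_prod_beta sum_distrib_right)
      also have "\<dots> = (\<Sum>(p, r)\<in>Sigma (splits m) (\<lambda>p. splits (fst p)).
          f (fst r) * g (snd r) * h (snd p))"
        by (rule sum.Sigma) auto
      also have "\<dots> = (\<Sum>(p, r)\<in>Sigma (splits m) (\<lambda>p. splits (snd p)).
          f (fst p) * (g (fst r) * h (snd r)))"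
        by (rule sum.reindex_bij_witness[where
              i = "\<lambda>((a, b), (c, d)). ((a + c, d), (a, c))" and
              j = "\<lambda>((a, b), (c, d)). ((c, d + b), (d, b))"])
          (auto simp: splits_def algebra_simps)
      also have "\<dots> = (\<Sum>p\<in>splits m. \<Sum>r\<in>splits (snd p). f (fst p) * (g (fst r) * h (snd r)))"
        by (rule sum.Sigma[symmetric]) auto
      also have "\<dots> = (\<Sum>(a, b)\<in>splits m. f a * (\<Sum>(c, d)\<in>splits b. g c * h d))"
        by (simp add: case_prod_beta sum_distrib_left)
      finally show ?thesis .
    qed
    then show "(\<lambda>m. \<Sum>(a, b)\<in>splits m. (\<Sum>(c, d)\<in>splits a. f c * g d) * h b) =
      (\<lambda>m. \<Sum>(a, b)\<in>splits m. f a * (\<Sum>(c, d)\<in>splits b. g c * h d))"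
      by auto
  qed
  show "1 * f = f"
  proof transfer
    fix f :: "monomial \<Rightarrow> 'a"
    have "(\<Sum>(a, b)\<in>splits m. (if a = 0 then 1 else 0) * f b) = f m" for m
    proof -
      have "(\<Sum>(a, b)\<in>splits m. (if a = 0 then 1 else 0) * f b) =
        (\<Sum>p\<in>{(0 :: monomial, m)}. (if fst p = 0 then 1 else 0) * f (snd p))"
        unfolding case_prod_beta
        by (rule sum.mono_neutral_right, rule finite_splits) (auto simp: splits_def)
      then show ?thesis
        by simp
    qed
    then show "(\<lambda>m. \<Sum>(a, b)\<in>splits m. (if a = 0 then 1 else 0) * f b) = f"
      by auto
  qed
  show "(f + g) * h = f * h + g * h"
    by transfer (simp add: case_prod_beta distrib_right sum.distrib)
  show "(0 :: 'a mps) \<noteq> 1"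
    by transfer (auto simp: fun_eq_iff)
qed (transfer; simp add: algebra_simps)+

end

lift_definition mps_const :: "'a::zero \<Rightarrow> 'a mps" is "\<lambda>c m. if m = 0 then c else 0" .

text \<open>
  The formal sum over \<open>i \<in> I\<close> of \<open>c i\<close> times the monomial \<open>\<mu> i\<close>. It is meaningful for infinite
  \<open>I\<close> whenever each monomial is attained by finitely many \<open>i\<close>, which is the case below
  (\<open>finite_elementary_fibre\<close>, \<open>finite_colouring_fibre\<close>).
\<close>

definition mps_sum :: "'i set \<Rightarrow> ('i \<Rightarrow> 'a::comm_monoid_add) \<Rightarrow> ('i \<Rightarrow> monomial) \<Rightarrow> 'a mps" where
  "mps_sum I c \<mu> = Abs_mps (\<lambda>m. \<Sum>i\<in>{i\<in>I. \<mu> i = m}. c i)"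

lemma mps_coeff_mps_sum: "mps_coeff (mps_sum I c \<mu>) m = (\<Sum>i\<in>{i\<in>I. \<mu> i = m}. c i)"
  by (simp add: mps_sum_def Abs_mps_inverse)


section \<open>Symmetric functions over the field of rational functions in \<open>q\<close>\<close>

definition monomial_degree :: "monomial \<Rightarrow> nat" where
  "monomial_degree m = (\<Sum>i\<in>Poly_Mapping.keys m. Poly_Mapping.lookup m i)"

definition symmetric_functions :: "'a::comm_ring_1 mps set" where
  "symmetric_functions = {f.
     (\<exists>d. \<forall>m. mps_coeff f m \<noteq> 0 \<longrightarrow> monomial_degree m \<le> d) \<and>
     (\<forall>\<sigma> m. bij \<sigma> \<longrightarrow> mps_coeff f (Poly_Mapping.map_key \<sigma> m) = mps_coeff f m)}"

type_synonym K = "rat poly fract"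

definition q :: K where
  "q = Fract [:0, 1:] 1"

abbreviation \<Lambda> :: "K mps set" where
  "\<Lambda> \<equiv> symmetric_functions"

abbreviation var :: "nat \<Rightarrow> monomial" where
  "var i \<equiv> Poly_Mapping.single i 1"

definition elem_sym :: "nat \<Rightarrow> 'a::comm_ring_1 mps" where
  "elem_sym k = mps_sum {S. finite S \<and> card S = k} (\<lambda>_. 1) (\<lambda>S. \<Sum>i\<in>S. var i)"

definition elem_sym_list :: "nat list \<Rightarrow> 'a::comm_ring_1 mps" where
  "elem_sym_list \<alpha> = prod_list (map elem_sym \<alpha>)"

definition compositions :: "nat \<Rightarrow> nat list set" where
  "compositions n = {\<alpha>. (\<forall>a\<in>set \<alpha>. a > 0) \<and> sum_list \<alpha> = n}"

lemma length_composition_le: "\<alpha> \<in> compositions n \<Longrightarrow> length \<alpha> \<le> n"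
proof -
  have "\<forall>a\<in>set \<alpha>. a > 0 \<Longrightarrow> length \<alpha> \<le> sum_list \<alpha>" for \<alpha> :: "nat list"
    by (induction \<alpha>) (auto simp: Suc_le_eq add_strict_increasing)
  then show "\<alpha> \<in> compositions n \<Longrightarrow> length \<alpha> \<le> n"
    by (auto simp: compositions_def)
qed

lemma finite_compositions [simp]: "finite (compositions n)"
proof (rule finite_subset)
  show "compositions n \<subseteq> {\<alpha>. set \<alpha> \<subseteq> {..n} \<and> length \<alpha> \<le> n}"
    using length_composition_le by (auto simp: compositions_def member_le_sum_list)
  show "finite {\<alpha>. set \<alpha> \<subseteq> {..n} \<and> length \<alpha> \<le> n}"
    by (rule finite_lists_length_le) simp
qed

lemma keys_add_monomial:
  "Poly_Mapping.keys (a + b :: monomial) = Poly_Mapping.keys a \<union> Poly_Mapping.keys b"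
  by (auto simp: in_keys_iff lookup_add)

lemma keys_sum_var: "finite S \<Longrightarrow> Poly_Mapping.keys (\<Sum>i\<in>S. var (\<kappa> i)) = \<kappa> ` S"
  by (induction S rule: finite_induct) (simp_all add: keys_add_monomial)

lemma finite_elementary_fibre:
  "finite {S \<in> {S. finite S \<and> card S = k}. (\<Sum>i\<in>S. var i) = m}"
  by (rule finite_subset[of _ "{Poly_Mapping.keys m}"])
    (auto simp: keys_sum_var[where \<kappa> = "\<lambda>i. i"] simp del: One_nat_def)


section \<open>Dyck paths\<close>

datatype step = N | E

type_synonym path = "step list"

definition DYCK :: "path set" where
  "DYCK = {P. count_list P N = count_list P E \<and>
     (\<forall>U W. P = U @ [E] @ W \<longrightarrow> count_list U E < count_list U N)}"

definition path_size :: "path \<Rightarrow> nat" where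
  "path_size P = count_list P N"

definition endpoint :: "path \<Rightarrow> nat \<times> nat" where
  "endpoint P = (count_list P E, count_list P N)"

definition lattice_points :: "path \<Rightarrow> (nat \<times> nat) set" where
  "lattice_points P = {endpoint U | U W. P = U @ W}"

text \<open>
  From a point \<open>(u\<^sub>1, u\<^sub>0)\<close> of a Dyck path, the bounce path goes south to \<open>(u\<^sub>1, u\<^sub>1)\<close> and then west to
  the first point of the path, which is the one with the largest abscissa.
\<close>

definition bounce_point :: "path \<Rightarrow> nat \<times> nat \<Rightarrow> nat \<times> nat" where
  "bounce_point P u = ((GREATEST a. a \<le> fst u \<and> (a, fst u) \<in> lattice_points P), fst u)"

text \<open>\<open>A\<close>, \<open>B\<close>, \<open>C\<close> are the three factors separated by the two marker dots.\<close>

definition bounce_decomposition :: "path \<Rightarrow> nat \<times> nat \<Rightarrow> path \<Rightarrow> path \<Rightarrow> path \<Rightarrow> bool" where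
  "bounce_decomposition P u A B C \<longleftrightarrow>
     P = A @ B @ C \<and>
     (\<exists>U s1 s2 V s3 s4 W. A = U @ [s1] \<and> B = [s2] @ V @ [s3] \<and> C = [s4] @ W) \<and>
     endpoint A = bounce_point P u \<and> endpoint (A @ B) = u"


section \<open>Unicellular LLT polynomials\<close>

definition plane_point :: "nat \<times> nat \<Rightarrow> real \<times> real" where
  "plane_point u = (real (fst u), real (snd u))"

definition path_curve :: "path \<Rightarrow> (real \<times> real) set" where
  "path_curve P =
     \<Union> {closed_segment (plane_point (endpoint U)) (plane_point (endpoint (U @ [s]))) | U s W.
           P = U @ [s] @ W}"

definition path_region :: "path \<Rightarrow> (real \<times> real) set" where
  "path_region P = {(a, b). a \<le> b \<and> (\<exists>c. b \<le> c \<and> (a, c) \<in> path_curve P)}"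

text \<open>An edge \<open>{x, y}\<close> with \<open>x < y\<close> is represented by the pair \<open>(x, y)\<close>.\<close>

definition graph_edges :: "path \<Rightarrow> (nat \<times> nat) set" where
  "graph_edges P = {(x, y). 1 \<le> x \<and> x < y \<and> y \<le> path_size P \<and>
     {real x - 1..real x} \<times> {real y - 1..real y} \<subseteq> path_region P}"

definition asc :: "path \<Rightarrow> (nat \<Rightarrow> nat) \<Rightarrow> nat" where
  "asc P \<kappa> = card {(x, y) \<in> graph_edges P. \<kappa> x < \<kappa> y}"

definition colourings :: "nat \<Rightarrow> (nat \<Rightarrow> nat) set" where
  "colourings n = {1..n} \<rightarrow>\<^sub>E UNIV"

definition LLT :: "path \<Rightarrow> K mps" where
  "LLT P = mps_sum (colourings (path_size P)) (\<lambda>\<kappa>. q ^ asc P \<kappa>)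
     (\<lambda>\<kappa>. \<Sum>i\<in>{1..path_size P}. var (\<kappa> i))"

lemma finite_colouring_fibre: "finite {\<kappa> \<in> colourings n. (\<Sum>i\<in>{1..n}. var (\<kappa> i)) = m}"
proof (rule finite_subset)
  show "{\<kappa> \<in> colourings n. (\<Sum>i\<in>{1..n}. var (\<kappa> i)) = m} \<subseteq> {1..n} \<rightarrow>\<^sub>E Poly_Mapping.keys m"
    by (auto simp: colourings_def keys_sum_var simp del: One_nat_def)
  show "finite ({1..n} \<rightarrow>\<^sub>E Poly_Mapping.keys m)"
    by (intro finite_PiE) auto
qed


section \<open>The characterising relations\<close>

definition initial_values :: "(path \<Rightarrow> K mps) \<Rightarrow> bool" where
  "initial_values F \<longleftrightarrow>
     (\<forall>k. F ([N] @ concat (replicate k [N, E]) @ [E]) =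
        (\<Sum>\<alpha>\<in>compositions (k + 1).
           mps_const ((q - 1) ^ (k + 1 - length \<alpha>)) * elem_sym_list \<alpha>))"

definition multiplicative :: "(path \<Rightarrow> K mps) \<Rightarrow> bool" where
  "multiplicative F \<longleftrightarrow> (\<forall>P\<in>DYCK. \<forall>Q\<in>DYCK. F (P @ Q) = F P * F Q)"

definition bounce_relations :: "(path \<Rightarrow> K mps) \<Rightarrow> bool" where
  "bounce_relations F \<longleftrightarrow>
     (\<forall>P\<in>DYCK. \<forall>x z. (x, z) \<in> lattice_points P \<and> x + 1 < z \<longrightarrow>
        (\<forall>U V W. bounce_decomposition P (x, z) (U @ [N]) ([N] @ V @ [N, E]) ([E] @ W) \<longrightarrow>
           F (U @ [N, N] @ V @ [N, E, E] @ W) =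
             mps_const (q + 1) * F (U @ [N, N] @ V @ [E, N, E] @ W)
             - mps_const q * F (U @ [N, N] @ V @ [E, E, N] @ W)) \<and>
        (\<forall>U V W. bounce_decomposition P (x, z) (U @ [N, E]) ([N] @ V @ [N, E]) ([E] @ W) \<longrightarrow>
           F (U @ [E, N, N] @ V @ [E, N, E] @ W)
             + F (U @ [N, E, N] @ V @ [N, E, E] @ W)
             + F (U @ [N, N, E] @ V @ [E, E, N] @ W) =
           F (U @ [E, N, N] @ V @ [N, E, E] @ W)
             + F (U @ [N, E, N] @ V @ [E, E, N] @ W)
             + F (U @ [N, N, E] @ V @ [E, N, E] @ W)))"

end

theory Submission
  imports Defs
begin

text \<open>
  Uniqueness: in a Dyck path that is neither empty nor a product, look at the first two adjacent east
  steps and let \<open>(x, z)\<close> be the point between them. If \<open>x + 1 = z\<close>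
  the path is one of the initial ones; otherwise the last point at height \<open>x\<close> lies before
  these steps and is preceded by \<open>n\<close> or \<open>ne\<close>, so one of the two relations applies. All other paths in that
  relation have a smaller sum of squared positions of the east steps. The same induction yields the
  symmetry of the LLT polynomials from their relations.

  The relations for LLT polynomials: let \<open>a = x\<close>, \<open>b = x + 1\<close>. In the path obtained by deleting the
  cells that vary in the relation, the vertices \<open>a < b\<close> are adjacent twins. Adding up the weights of
  a colouring and of the colouring with the colours of \<open>a\<close> and \<open>b\<close> exchanged gives a pointwise
  identity.

  The initial values: a word whose weight is \<open>q\<close> to the number of ascents is expanded according to
  the strictly increasing prefixes that can be split off, each such prefix of length \<open>j\<close> carrying
  \<open>(q - 1)\<^sup>j\<^sup>-\<^sup>1\<close> and contributing a factor \<open>e\<^sub>j\<close>.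
\<close>

section \<open>Bounce induction on Dyck paths\<close>

text \<open>\<open>walk h P\<close> is the distance to the diagonal after \<open>P\<close>, starting from distance \<open>h\<close>.\<close>

fun walk :: "nat \<Rightarrow> path \<Rightarrow> nat option" where
  "walk h [] = Some h"
| "walk h (N # P) = walk (Suc h) P"
| "walk 0 (E # P) = None"
| "walk (Suc h) (E # P) = walk h P"

lemma walk_append: "walk h (P @ Q) = Option.bind (walk h P) (\<lambda>i. walk i Q)"
  by (induction h P rule: walk.induct) auto

lemma walk_count: "walk h P = Some i \<Longrightarrow> h + count_list P N = i + count_list P E"
  by (induction h P rule: walk.induct) auto

text \<open>\<open>walk\<close> fails exactly at an east step met at distance 0, which is what
  \<open>DYCK\<close> forbids in each factorisation around an east step. Peeling off the first
  letter shifts the starting distance \<open>h\<close>.\<close>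

lemma walk_eq_Some_iff:
  "walk h P = Some i \<longleftrightarrow> h + count_list P N = i + count_list P E \<and>
     (\<forall>U W. P = U @ [E] @ W \<longrightarrow> count_list U E < h + count_list U N)"
proof (induction h P rule: walk.induct)
  case (2 h P)
  have "(\<forall>U W. N # P = U @ [E] @ W \<longrightarrow> count_list U E < h + count_list U N) \<longleftrightarrow>
    (\<forall>U W. P = U @ [E] @ W \<longrightarrow> count_list U E < Suc h + count_list U N)" (is "?l \<longleftrightarrow> ?r")
  proof
    assume l: ?l
    show ?r
    proof (intro allI impI)
      fix U W assume "P = U @ [E] @ W"
      with l[rule_format, of "N # U" W] show "count_list U E < Suc h + count_list U N"
        by simp
    qed
  next
    assume ?r
    then show ?l by (auto simp: Cons_eq_append_conv)
  qed
  with 2 show ?case by simp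
next
  case (3 P)
  have "\<exists>U W. E # P = U @ [E] @ W \<and> \<not> count_list U E < 0 + count_list U N"
    by (rule exI[of _ "[]"]) simp
  then show ?case by auto
next
  case (4 h P)
  have "(\<forall>U W. E # P = U @ [E] @ W \<longrightarrow> count_list U E < Suc h + count_list U N) \<longleftrightarrow>
    (\<forall>U W. P = U @ [E] @ W \<longrightarrow> count_list U E < h + count_list U N)" (is "?l \<longleftrightarrow> ?r")
  proof
    assume l: ?l
    show ?r
    proof (intro allI impI)
      fix U W assume "P = U @ [E] @ W"
      with l[rule_format, of "E # U" W] show "count_list U E < h + count_list U N"
        by simp
    qed
  next
    assume ?r
    then show ?l by (auto simp: Cons_eq_append_conv)
  qed
  with 4 show ?case by simp
qed auto

lemma DYCK_iff_walk: "P \<in> DYCK \<longleftrightarrow> walk 0 P = Some 0"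
  by (simp add: DYCK_def walk_eq_Some_iff)

text \<open>
  Squares make the weight drop when an east step moves forward and a later one moves back, which
  is what happens to the term of equal area in the second bounce relation.
\<close>

fun E_weight :: "nat \<Rightarrow> path \<Rightarrow> nat" where
  "E_weight k [] = 0"
| "E_weight k (s # P) = (if s = E then k * k else 0) + E_weight (Suc k) P"

lemma E_weight_append: "E_weight k (P @ Q) = E_weight k P + E_weight (k + length P) Q"
  by (induction P arbitrary: k) auto

section \<open>Words without two adjacent east steps\<close>

definition EE_free :: "path \<Rightarrow> bool" where
  "EE_free P \<longleftrightarrow> (\<nexists>U W. P = U @ [E, E] @ W)"

lemma EE_free_ConsD: "EE_free (s # P) \<Longrightarrow> EE_free P"
  unfolding EE_free_def by (metis append_Cons)

lemma EE_free_before_E: "EE_free (U @ s # E # W) \<Longrightarrow> s = N"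
  unfolding EE_free_def by (cases s) auto

lemma EE_free_Cons_Cons: "EE_free (E # s # P) \<Longrightarrow> s = N"
  unfolding EE_free_def by (metis append_Cons append_Nil step.exhaust)

text \<open>After the initial north step every east step directly follows a north step of its own,
  so the induction removes \<open>N\<close> or \<open>N E\<close> from the front.\<close>

lemma EE_free_count_le: "EE_free (N # P) \<Longrightarrow> count_list (N # P) E \<le> count_list (N # P) N"
proof (induction P rule: length_induct)
  case (1 P)
  show ?case
  proof (cases P)
    case (Cons s R)
    show ?thesis
    proof (cases s)
      case N
      with 1 Cons EE_free_ConsD[of N P] show ?thesis by fastforce
    next
      case E
      show ?thesis
      proof (cases R)
        case (Cons t R')
        then have "t = N" "EE_free (t # R')"
          using 1(2) EE_free_ConsD EE_free_Cons_Cons \<open>P = s # R\<close> E by blast+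
        with 1(1) Cons \<open>P = s # R\<close> E show ?thesis by fastforce
      qed (use Cons E in simp)
    qed
  qed simp
qed

text \<open>If the word began with two north steps, \<open>EE_free_count_le\<close> applied after
  the first of them would leave north steps in excess. Hence pairs \<open>N E\<close> split off one
  by one.\<close>

lemma EE_free_balanced:
  "EE_free (N # P) \<Longrightarrow> count_list (N # P) N = count_list (N # P) E \<Longrightarrow>
    \<exists>k. N # P = concat (replicate k [N, E])"
proof (induction P rule: length_induct)
  case (1 P)
  show ?case
  proof (cases P)
    case (Cons s R)
    show ?thesis
    proof (cases s)
      case N
      then show ?thesis
        using 1(2,3) Cons EE_free_count_le[of R] EE_free_ConsD[of N P] by simp
    next
      case E
      show ?thesis
      proof (cases R)
        case Nil
        then show ?thesis using Cons E by (intro exI[of _ 1]) simp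
      next
        case (Cons t R')
        then have t: "t = N" "EE_free (t # R')"
          using 1(2) EE_free_ConsD EE_free_Cons_Cons \<open>P = s # R\<close> E by blast+
        then obtain k where "N # R' = concat (replicate k [N, E])"
          using 1 Cons \<open>P = s # R\<close> E by fastforce
        then show ?thesis
          using Cons \<open>P = s # R\<close> E t by (intro exI[of _ "Suc k"]) simp
      qed
    qed
  qed (use 1 in simp)
qed

text \<open>Taking the shortest \<open>U\<close> makes the double step the first one. The letter
  \<open>E\<close> is kept after \<open>U\<close> in order to control the letter before it.\<close>

lemma first_EE:
  assumes "\<not> EE_free P"
  obtains U W where "P = U @ [E, E] @ W" "EE_free (U @ [E])"
proof -
  define k where "k = (LEAST k. \<exists>U W. P = U @ [E, E] @ W \<and> length U = k)"
  have ex: "\<exists>k U W. P = U @ [E, E] @ W \<and> length U = k"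
    using assms by (simp add: EE_free_def)
  have "\<exists>U W. P = U @ [E, E] @ W \<and> length U = k"
    unfolding k_def using ex by (rule LeastI_ex)
  then obtain U W where P: "P = U @ [E, E] @ W" and U: "length U = k"
    by blast
  have "EE_free (U @ [E])"
    unfolding EE_free_def
  proof
    assume "\<exists>U' W'. U @ [E] = U' @ [E, E] @ W'"
    then obtain U' W' where eq: "U @ [E] = U' @ [E, E] @ W'"
      by blast
    then have "P = U' @ [E, E] @ (W' @ E # W)"
      using P by (metis append.assoc append_Cons append_Nil)
    then have "k \<le> length U'"
      unfolding k_def by (intro Least_le) blast
    with arg_cong[OF eq, of length] U show False
      by simp
  qed
  with P that show thesis by blast
qed

section \<open>Bounce decompositions and the case split for Dyck paths\<close>

lemma split_at_nth_occurrence: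
  "k < count_list P s \<Longrightarrow> \<exists>A V. P = A @ s # V \<and> count_list A s = k"
proof (induction P arbitrary: k)
  case (Cons t P)
  show ?case
  proof (cases "t = s \<and> k = 0")
    case True
    then show ?thesis by - (rule exI[of _ "[]"], simp)
  next
    case False
    then have "(if t = s then k - 1 else k) < count_list P s"
      using Cons.prems by (auto split: if_splits)
    then obtain A V where "P = A @ s # V" "count_list A s = (if t = s then k - 1 else k)"
      using Cons.IH by blast
    then show ?thesis using False by - (rule exI[of _ "t # A"], auto)
  qed
qed simp

text \<open>The middle factor starts with \<open>N\<close>, so the path leaves height
  \<open>x\<close> at the end of \<open>U @ [s]\<close>. No later point has that height and no
  earlier one has a larger abscissa, so this is the point selected by \<open>GREATEST\<close> in
  \<open>bounce_point\<close>.\<close>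

lemma bounce_decompositionI:
  assumes "P = (U @ [s]) @ ([N] @ V @ [s']) @ ([t] @ W)"
    and "count_list (U @ [s]) N = x" "count_list (U @ [s] @ [N] @ V @ [s']) E = x"
    and "count_list (U @ [s] @ [N] @ V @ [s']) N = z"
  shows "bounce_decomposition P (x, z) (U @ [s]) ([N] @ V @ [s']) ([t] @ W)"
proof -
  let ?A = "U @ [s]"
  have "(GREATEST a. a \<le> x \<and> (a, x) \<in> lattice_points P) = count_list ?A E"
  proof (rule Greatest_equality)
    show "count_list ?A E \<le> x \<and> (count_list ?A E, x) \<in> lattice_points P"
    proof
      show "count_list ?A E \<le> x" using assms(3) by auto
      have "P = ?A @ ([N] @ V @ [s'] @ t # W)" using assms(1) by simp
      then have "endpoint ?A \<in> lattice_points P"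
        unfolding lattice_points_def by blast
      then show "(count_list ?A E, x) \<in> lattice_points P"
        using assms(2) by (simp add: endpoint_def)
    qed
  next
    fix a assume "a \<le> x \<and> (a, x) \<in> lattice_points P"
    then obtain T R where T: "a = count_list T E" "x = count_list T N" "P = T @ R"
      by (auto simp: lattice_points_def endpoint_def)
    have "(?A @ [N]) @ (V @ [s'] @ t # W) = T @ R"
      using T(3) assms(1) by simp
    \<comment> \<open>Two prefixes of one word are comparable; the first case would put the end of
      \<open>T\<close> above height \<open>x\<close>.\<close>
    then consider Z where "?A @ [N] @ Z = T" | Z where "?A @ [N] = T @ Z"
      unfolding append_eq_append_conv2 by (metis append.assoc)
    then show "a \<le> count_list ?A E"
    proof cases
      case 1
      then have "count_list T N \<ge> count_list (?A @ [N]) N"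
        by auto
      then show ?thesis using assms(2) T(2) by (simp split: if_splits)
    next
      case 2
      have "count_list (?A @ [N]) E = count_list (T @ Z) E"
        using 2 by simp
      then show ?thesis using T(1) by (simp split: if_splits)
    qed
  qed
  then have "endpoint ?A = bounce_point P (x, z)"
    using assms(2) by (simp add: bounce_point_def endpoint_def)
  moreover have "endpoint (?A @ [N] @ V @ [s']) = (x, z)"
    using assms(3,4) by (simp add: endpoint_def)
  ultimately show ?thesis
    using assms(1) unfolding bounce_decomposition_def by (auto simp: append_assoc)
qed

lemma bounce_decompositionD:
  assumes "bounce_decomposition P (x, z) A B C"
  shows "P = A @ B @ C" "count_list A N = x" "count_list (A @ B) E = x" "count_list (A @ B) N = z"
  using assms by (auto simp: bounce_decomposition_def endpoint_def bounce_point_def)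

text \<open>The count equations in the last two cases state that the abscissa of the point between
  the two adjacent east steps equals the height reached after \<open>U @ [N]\<close> or
  \<open>U @ [N, E]\<close>, as the bounce path demands.\<close>

lemma DYCK_cases:
  assumes "P \<in> DYCK"
  obtains (nil) "P = []"
  | (append) Q R where "P = Q @ R" "Q \<noteq> []" "R \<noteq> []" "Q \<in> DYCK" "R \<in> DYCK"
  | (initial) k where "P = [N] @ concat (replicate k [N, E]) @ [E]"
  | (three) U V W where "P = U @ [N, N] @ V @ [N, E, E] @ W"
      "count_list U N = count_list U E + count_list V E"
  | (six) U V W where "P = U @ [N, E, N] @ V @ [N, E, E] @ W"
      "count_list U N = Suc (count_list U E + count_list V E)"
proof -
  have w: "walk 0 P = Some 0"
    using assms by (simp add: DYCK_iff_walk)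
  consider "P = []" | R where "P = [N, E] @ R" | R where "P = [N, N] @ R"
    using w by (cases "(0 :: nat, P)" rule: walk.cases; cases "(1 :: nat, tl P)" rule: walk.cases)
      (auto simp: neq_Nil_conv)
  then show thesis
  proof cases
    case 1
    then show thesis by (rule nil)
  next
    case (2 R)
    then show thesis
      using append[of "[N, E]" R] initial[of 0] w by (cases "R = []") (auto simp: DYCK_iff_walk)
  next
    case (3 R)
    \<comment> \<open>Otherwise the word after the first north step would have one more east step
      than north steps, contrary to \<open>EE_free_count_le\<close>.\<close>
    have "\<not> EE_free P"
    proof
      assume "EE_free P"
      then have "EE_free (N # R)"
        using 3 EE_free_ConsD[of N "N # R"] by simp
      from EE_free_count_le[OF this] walk_count[OF w] 3 show False
        by simp
    qed
    then obtain X W where P: "P = X @ [E, E] @ W" and X: "EE_free (X @ [E])"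
      by (rule first_EE)
    have "X \<noteq> []"
      using P 3 by auto
    then obtain Y s where Y: "X = Y @ [s]"
      by (cases X rule: rev_cases) auto
    have s: "s = N"
      using X Y EE_free_before_E[of Y s "[]"] by simp
    \<comment> \<open>Abscissa of the point between the two east steps. Its height is
      \<open>x + j + 1\<close>, where \<open>j\<close> is the distance to the diagonal after both of
      them; thus \<open>j = 0\<close> is the case where the path returns to the diagonal.\<close>
    define x where "x = Suc (count_list Y E)"
    have PY: "P = Y @ [N, E, E] @ W"
      using P Y s by simp
    obtain i where i: "walk 0 Y = Some i" "walk (Suc i) ([E, E] @ W) = Some 0"
      using w PY by (auto simp: walk_append bind_eq_Some_conv)
    then obtain j where j: "i = Suc j" "walk j W = Some 0"
      by (cases i) auto
    have cY: "count_list Y N = x + j"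
      using walk_count[OF i(1)] j by (simp add: x_def)
    show thesis
    proof (cases j)
      case 0
      have walkQ: "walk 0 (Y @ [N, E, E]) = Some 0"
        using i j 0 by (simp add: walk_append)
      show thesis
      proof (cases "W = []")
        case False
        then show thesis
          using append[of "Y @ [N, E, E]" W] walkQ j 0 PY by (simp add: DYCK_iff_walk)
      next
        case True
        have "Y \<noteq> []"
          using PY 3 by auto
        then consider "Y = [N]" | Z where "Y = N # N # Z"
          using PY 3 by (cases Y; cases "tl Y") auto
        then show thesis
        proof cases
          case 1
          then show thesis
            using initial[of 1] PY True by simp
        next
          case Z: (2 Z)
          have "EE_free (N # Z @ [N, E])"
            using X Y s Z EE_free_ConsD[of N "N # Z @ [N, E]"] by simp
          moreover have "count_list (N # Z @ [N, E]) N = count_list (N # Z @ [N, E]) E"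
            using cY Z 0 by (simp add: x_def)
          ultimately obtain k where "N # Z @ [N, E] = concat (replicate k [N, E])"
            using EE_free_balanced by blast
          moreover have "P = [N] @ (N # Z @ [N, E]) @ [E]"
            using PY Z True by simp
          ultimately show thesis
            using initial[of k] by simp
        qed
      qed
    next
      case (Suc j')
      then have "x < count_list Y N"
        using cY by simp
      \<comment> \<open>\<open>A\<close> ends at the last point of height \<open>x\<close>: the next
        letter is the north step that leaves this height.\<close>
      then obtain A V where A: "Y = A @ N # V" "count_list A N = x"
        using split_at_nth_occurrence[of x Y N] by blast
      then have "A \<noteq> []"
        by (auto simp: x_def)
      then obtain B t where B: "A = B @ [t]"
        by (cases A rule: rev_cases) auto
      show thesis
      proof (cases t)
        case N
        then show thesis
          using three[of B V W] A B PY by (simp add: x_def)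
      next
        case E
        have "B \<noteq> []"
          using A(1) B PY 3 E by auto
        then obtain C u where C: "B = C @ [u]"
          by (cases B rule: rev_cases) auto
        \<comment> \<open>This word ends with the first of the two adjacent east steps, so
          \<open>u = E\<close> would give an earlier double step.\<close>
        have "EE_free (C @ u # E # N # V @ [s, E])"
          using X Y A B C E by simp
        then have "u = N"
          by (rule EE_free_before_E)
        then show thesis
          using six[of C V W] A B C E PY by (simp add: x_def)
      qed
    qed
  qed
qed

section \<open>The induction principle along bounce relations\<close>

lemma three_term_variants_in_DYCK:
  assumes "U @ [N, N] @ V @ [N, E, E] @ W \<in> DYCK"
    and "count_list U N = count_list U E + count_list V E"
  shows "U @ [N, N] @ V @ [E, N, E] @ W \<in> DYCK" "U @ [N, N] @ V @ [E, E, N] @ W \<in> DYCK"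
proof -
  obtain i j where i: "walk 0 U = Some i" and j: "walk (Suc (Suc i)) V = Some j"
    and W: "walk j (N # E # E # W) = Some 0"
    using assms(1) by (auto simp: DYCK_iff_walk walk_append bind_eq_Some_conv)
  \<comment> \<open>The count equation leaves distance at least 2 before the last block, so both of
    its east steps may come first.\<close>
  have "j = Suc (Suc (count_list V N))"
    using walk_count[OF i] walk_count[OF j] assms(2) by simp
  with i j W show "U @ [N, N] @ V @ [E, N, E] @ W \<in> DYCK" "U @ [N, N] @ V @ [E, E, N] @ W \<in> DYCK"
    by (simp_all add: DYCK_iff_walk walk_append)
qed

lemma six_term_variants_in_DYCK:
  assumes "U @ [N, E, N] @ V @ [N, E, E] @ W \<in> DYCK"
    and "count_list U N = Suc (count_list U E + count_list V E)"
    and "X \<in> {[E, N, N], [N, E, N], [N, N, E]}" "Y \<in> {[E, E, N], [E, N, E], [N, E, E]}"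
  shows "U @ X @ V @ Y @ W \<in> DYCK"
proof -
  obtain i j where i: "walk 0 U = Some i" and j: "walk (Suc i) V = Some j"
    and W: "walk j (N # E # E # W) = Some 0"
    using assms(1) by (auto simp: DYCK_iff_walk walk_append bind_eq_Some_conv)
  \<comment> \<open>An east step may open the first block since \<open>i\<close> is positive, and
    two may open the last block since \<open>j\<close> is at least 2.\<close>
  have "i = Suc (count_list V E)" "j = Suc (Suc (count_list V N))"
    using walk_count[OF i] walk_count[OF j] assms(2) by simp_all
  with i j W assms(3,4) show ?thesis
    by (auto simp: DYCK_iff_walk walk_append)
qed

text \<open>Induction on length, then on \<open>E_weight\<close>: proper factors of a product are
  shorter, and the other paths of a bounce relation have the same length and smaller weight. The
  cases carry a bounce decomposition in the form in which \<open>bounce_relations\<close> asks for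
  it.\<close>

lemma DYCK_bounce_induct [consumes 1, case_names nil initial append three six]:
  assumes "P \<in> DYCK"
    and nil: "\<Phi> []"
    and initial: "\<And>k. \<Phi> ([N] @ concat (replicate k [N, E]) @ [E])"
    and append: "\<And>P Q. P \<in> DYCK \<Longrightarrow> Q \<in> DYCK \<Longrightarrow> \<Phi> P \<Longrightarrow> \<Phi> Q \<Longrightarrow> \<Phi> (P @ Q)"
    and three: "\<And>P x z U V W. P \<in> DYCK \<Longrightarrow> (x, z) \<in> lattice_points P \<Longrightarrow> x + 1 < z \<Longrightarrow>
      bounce_decomposition P (x, z) (U @ [N]) ([N] @ V @ [N, E]) ([E] @ W) \<Longrightarrow>
      \<Phi> (U @ [N, N] @ V @ [E, N, E] @ W) \<Longrightarrow> \<Phi> (U @ [N, N] @ V @ [E, E, N] @ W) \<Longrightarrow>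
      \<Phi> (U @ [N, N] @ V @ [N, E, E] @ W)"
    and six: "\<And>P x z U V W. P \<in> DYCK \<Longrightarrow> (x, z) \<in> lattice_points P \<Longrightarrow> x + 1 < z \<Longrightarrow>
      bounce_decomposition P (x, z) (U @ [N, E]) ([N] @ V @ [N, E]) ([E] @ W) \<Longrightarrow>
      \<Phi> (U @ [E, N, N] @ V @ [E, N, E] @ W) \<Longrightarrow> \<Phi> (U @ [N, N, E] @ V @ [E, E, N] @ W) \<Longrightarrow>
      \<Phi> (U @ [E, N, N] @ V @ [N, E, E] @ W) \<Longrightarrow> \<Phi> (U @ [N, E, N] @ V @ [E, E, N] @ W) \<Longrightarrow>
      \<Phi> (U @ [N, N, E] @ V @ [E, N, E] @ W) \<Longrightarrow> \<Phi> (U @ [N, E, N] @ V @ [N, E, E] @ W)"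
  shows "\<Phi> P"
  using assms(1)
proof (induction P rule: wf_induct[OF wf_measures[of "[length, E_weight 0]"]])
  case (1 P)
  have IH: "\<Phi> Q" if "Q \<in> DYCK" "length Q < length P \<or> length Q = length P \<and> E_weight 0 Q < E_weight 0 P" for Q
    using 1(1) that by auto
  from \<open>P \<in> DYCK\<close> show ?case
  proof (cases rule: DYCK_cases)
    case nil
    then show ?thesis using assms(2) by simp
  next
    case (append Q R)
    then show ?thesis using assms(4) IH by simp
  next
    case (initial k)
    then show ?thesis using assms(3) by simp
  next
    case (three U V W)
    \<comment> \<open>Coordinates of the point between the two adjacent east steps. \<open>x\<close>
      counts the north steps of \<open>U @ [N]\<close>; by the count equation there are equally many
      east steps up to that point.\<close>
    define x where "x = Suc (count_list U N)"
    define z where "z = count_list U N + count_list V N + 3"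
    have bd: "bounce_decomposition P (x, z) (U @ [N]) ([N] @ V @ [N, E]) ([E] @ W)"
      using three bounce_decompositionI[of P U N "V @ [N]" E E W x z] by (simp add: x_def z_def)
    then have "(x, z) \<in> lattice_points P"
      unfolding bounce_decomposition_def lattice_points_def by (smt (verit) append_assoc mem_Collect_eq)
    moreover have "\<Phi> (U @ [N, N] @ V @ [E, N, E] @ W)" "\<Phi> (U @ [N, N] @ V @ [E, E, N] @ W)"
      by (rule IH; use three three_term_variants_in_DYCK \<open>P \<in> DYCK\<close>
          in \<open>simp add: E_weight_append algebra_simps\<close>)+
    ultimately show ?thesis
      using assms(5)[OF \<open>P \<in> DYCK\<close> _ _ bd] three(1) by (simp add: x_def z_def)
  next
    case (six U V W)
    define x where "x = Suc (count_list U N)"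
    define z where "z = count_list U N + count_list V N + 3"
    have bd: "bounce_decomposition P (x, z) (U @ [N, E]) ([N] @ V @ [N, E]) ([E] @ W)"
      using six bounce_decompositionI[of P "U @ [N]" E "V @ [N]" E E W x z] by (simp add: x_def z_def)
    then have xz: "(x, z) \<in> lattice_points P"
      unfolding bounce_decomposition_def lattice_points_def by (smt (verit) append_assoc mem_Collect_eq)
    have \<Phi>: "\<Phi> (U @ X @ V @ Y @ W)"
      if XY: "(X, Y) \<in> {([E, N, N], [E, N, E]), ([N, N, E], [E, E, N]), ([E, N, N], [N, E, E]),
        ([N, E, N], [E, E, N]), ([N, N, E], [E, N, E])}" for X Y
    proof (rule IH)
      show "U @ X @ V @ Y @ W \<in> DYCK"
        using six six_term_variants_in_DYCK[of U V W X Y] \<open>P \<in> DYCK\<close> that by auto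
      consider "X = [E, N, N]" "Y = [E, N, E]" | "X = [N, N, E]" "Y = [E, E, N]"
        | "X = [E, N, N]" "Y = [N, E, E]" | "X = [N, E, N]" "Y = [E, E, N]"
        | "X = [N, N, E]" "Y = [E, N, E]"
        using XY by blast
      then show "length (U @ X @ V @ Y @ W) < length P \<or>
        length (U @ X @ V @ Y @ W) = length P \<and> E_weight 0 (U @ X @ V @ Y @ W) < E_weight 0 P"
        by cases (simp_all add: six(1) E_weight_append algebra_simps)
    qed
    have "x + 1 < z"
      by (simp add: x_def z_def)
    show ?thesis
      unfolding six(1)
      by (rule assms(6)[OF \<open>P \<in> DYCK\<close> xz \<open>x + 1 < z\<close> bd \<Phi> \<Phi> \<Phi> \<Phi> \<Phi>]) simp_all
  qed
qed

section \<open>Symmetric functions\<close>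

lemma monomial_degree_add: "monomial_degree (a + b) = monomial_degree a + monomial_degree b"
proof -
  have superset: "monomial_degree c = (\<Sum>i\<in>Poly_Mapping.keys (a + b). Poly_Mapping.lookup c i)"
    if "c \<in> {a, b, a + b}" for c
    unfolding monomial_degree_def
    using that by (intro sum.mono_neutral_left) (auto simp: keys_add_monomial in_keys_iff)
  show ?thesis
    by (simp add: superset lookup_add sum.distrib)
qed

lemma monomial_degree_0_iff: "monomial_degree m = 0 \<longleftrightarrow> m = 0"
  by (auto simp: monomial_degree_def in_keys_iff intro!: poly_mapping_eqI) 

section \<open>Closure of the symmetric functions under ring operations\<close>

lemma symmetric_functions_add:
  assumes "f \<in> symmetric_functions" "g \<in> symmetric_functions"
  shows "f + g \<in> symmetric_functions"
proof -
  obtain d e where d: "\<And>m. mps_coeff f m \<noteq> 0 \<Longrightarrow> monomial_degree m \<le> d"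
    and e: "\<And>m. mps_coeff g m \<noteq> 0 \<Longrightarrow> monomial_degree m \<le> e"
    using assms by (auto simp: symmetric_functions_def)
  have "monomial_degree m \<le> max d e" if "mps_coeff (f + g) m \<noteq> 0" for m
  proof -
    have "mps_coeff f m \<noteq> 0 \<or> mps_coeff g m \<noteq> 0"
      using that by (auto simp: plus_mps.rep_eq)
    then show ?thesis
      using d[of m] e[of m] by auto
  qed
  then show ?thesis
    using assms by (auto simp: symmetric_functions_def plus_mps.rep_eq)
qed

lemma symmetric_functions_uminus: "f \<in> symmetric_functions \<Longrightarrow> - f \<in> symmetric_functions"
  by (simp add: symmetric_functions_def uminus_mps.rep_eq)

lemma symmetric_functions_diff:
  "f \<in> symmetric_functions \<Longrightarrow> g \<in> symmetric_functions \<Longrightarrow> f - g \<in> symmetric_functions"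
  using symmetric_functions_add[of f "- g"] symmetric_functions_uminus[of g] by simp

text \<open>Renaming variables is additive and invertible, so it matches the factorisations of a
  monomial with those of its image. This gives the symmetry of products.\<close>

lemma splits_map_key:
  assumes "bij \<sigma>"
  shows "bij_betw (map_prod (Poly_Mapping.map_key \<sigma>) (Poly_Mapping.map_key \<sigma>))
    (splits m) (splits (Poly_Mapping.map_key \<sigma> m))"
proof (rule bij_betw_byWitness[where
      f' = "map_prod (Poly_Mapping.map_key (inv \<sigma>)) (Poly_Mapping.map_key (inv \<sigma>))"])
  have inj: "inj \<sigma>" "inj (inv \<sigma>)"
    using assms by (auto simp: bij_is_inj bij_imp_bij_inv)
  have inverse: "Poly_Mapping.map_key (inv \<sigma>) (Poly_Mapping.map_key \<sigma> a) = a"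
    "Poly_Mapping.map_key \<sigma> (Poly_Mapping.map_key (inv \<sigma>) a) = a" for a :: monomial
  proof -
    have "inv \<sigma> \<circ> \<sigma> = id" "\<sigma> \<circ> inv \<sigma> = id"
      using assms by (auto simp: bij_def inj_iff surj_iff)
    then show "Poly_Mapping.map_key (inv \<sigma>) (Poly_Mapping.map_key \<sigma> a) = a"
      "Poly_Mapping.map_key \<sigma> (Poly_Mapping.map_key (inv \<sigma>) a) = a"
      using inj by (simp_all add: map_key_compose map_key_id[folded id_def])
  qed
  show "\<forall>p\<in>splits m. map_prod (Poly_Mapping.map_key (inv \<sigma>)) (Poly_Mapping.map_key (inv \<sigma>))
      (map_prod (Poly_Mapping.map_key \<sigma>) (Poly_Mapping.map_key \<sigma>) p) = p"
    "\<forall>p\<in>splits (Poly_Mapping.map_key \<sigma> m). map_prod (Poly_Mapping.map_key \<sigma>) (Poly_Mapping.map_key \<sigma>)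
      (map_prod (Poly_Mapping.map_key (inv \<sigma>)) (Poly_Mapping.map_key (inv \<sigma>)) p) = p"
    by (auto simp: inverse)
  show "map_prod (Poly_Mapping.map_key \<sigma>) (Poly_Mapping.map_key \<sigma>) ` splits m
      \<subseteq> splits (Poly_Mapping.map_key \<sigma> m)"
    using inj by (auto simp: splits_def map_key_plus)
  have "Poly_Mapping.map_key (inv \<sigma>) a + Poly_Mapping.map_key (inv \<sigma>) b = m"
    if "a + b = Poly_Mapping.map_key \<sigma> m" for a b
    using inj(2) that inverse(1)[of m] by (simp flip: map_key_plus)
  then show "map_prod (Poly_Mapping.map_key (inv \<sigma>)) (Poly_Mapping.map_key (inv \<sigma>)) `
      splits (Poly_Mapping.map_key \<sigma> m) \<subseteq> splits m"
    by (auto simp: splits_def)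
qed

lemma symmetric_functions_mult:
  assumes "f \<in> symmetric_functions" "g \<in> symmetric_functions"
  shows "f * g \<in> symmetric_functions"
proof -
  obtain d e where d: "\<And>m. mps_coeff f m \<noteq> 0 \<Longrightarrow> monomial_degree m \<le> d"
    and e: "\<And>m. mps_coeff g m \<noteq> 0 \<Longrightarrow> monomial_degree m \<le> e"
    using assms by (auto simp: symmetric_functions_def)
  have "monomial_degree m \<le> d + e" if "mps_coeff (f * g) m \<noteq> 0" for m
  proof -
    have "(\<Sum>(a, b)\<in>splits m. mps_coeff f a * mps_coeff g b) \<noteq> 0"
      using that by (simp add: times_mps.rep_eq)
    then obtain p where "p \<in> splits m" "(case p of (a, b) \<Rightarrow> mps_coeff f a * mps_coeff g b) \<noteq> 0"
      by (rule sum.not_neutral_contains_not_neutral)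
    then obtain a b where ab: "a + b = m" "mps_coeff f a * mps_coeff g b \<noteq> 0"
      by (auto simp: splits_def)
    then have "mps_coeff f a \<noteq> 0" "mps_coeff g b \<noteq> 0"
      by auto
    then show ?thesis
      using d[of a] e[of b] ab(1) by (auto simp: monomial_degree_add)
  qed
  moreover have "mps_coeff (f * g) (Poly_Mapping.map_key \<sigma> m) = mps_coeff (f * g) m" if "bij \<sigma>" for \<sigma> m
  proof -
    have "(\<Sum>p\<in>splits m. mps_coeff f (fst (map_prod (Poly_Mapping.map_key \<sigma>) (Poly_Mapping.map_key \<sigma>) p)) *
        mps_coeff g (snd (map_prod (Poly_Mapping.map_key \<sigma>) (Poly_Mapping.map_key \<sigma>) p))) =
      (\<Sum>p\<in>splits (Poly_Mapping.map_key \<sigma> m). mps_coeff f (fst p) * mps_coeff g (snd p))"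
      by (rule sum.reindex_bij_betw[OF splits_map_key[OF that]])
    then show ?thesis
      using assms that by (simp add: times_mps.rep_eq case_prod_beta symmetric_functions_def)
  qed
  ultimately show ?thesis
    unfolding symmetric_functions_def by blast
qed

lemma map_key_eq_0_iff:
  assumes "bij \<sigma>"
  shows "Poly_Mapping.map_key \<sigma> m = 0 \<longleftrightarrow> (m :: monomial) = 0"
proof
  assume eq: "Poly_Mapping.map_key \<sigma> m = 0"
  have "Poly_Mapping.lookup m i = 0" for i
  proof -
    obtain j where "i = \<sigma> j"
      using assms by (metis bij_pointE)
    then have "Poly_Mapping.lookup m i = Poly_Mapping.lookup (Poly_Mapping.map_key \<sigma> m) j"
      using assms by (simp add: map_key.rep_eq bij_is_inj)
    then show ?thesis by (simp add: eq)
  qed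
  then show "m = 0"
    by (intro poly_mapping_eqI) simp
qed (use assms in \<open>simp add: bij_is_inj\<close>)

lemma mps_const_in_symmetric_functions: "mps_const c \<in> symmetric_functions"
  unfolding symmetric_functions_def
  by (auto simp: mps_const.rep_eq map_key_eq_0_iff intro!: exI[of _ 0]) (auto simp: monomial_degree_def)

lemma lookup_sum_var: "finite S \<Longrightarrow> Poly_Mapping.lookup (\<Sum>i\<in>S. var i) j = (if j \<in> S then 1 else 0)"
  by (simp add: lookup_sum lookup_single when_def)

text \<open>The monomials that occur are squarefree of degree \<open>k\<close>. As
  \<open>map_key \<sigma>\<close> pulls exponents back along \<sigma>, a set \<open>S\<close> for
  the renamed monomial corresponds to its image under \<sigma> for the original one.\<close>

lemma elem_sym_in_symmetric_functions: "elem_sym k \<in> symmetric_functions"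
proof -
  have "monomial_degree m \<le> k" if nz: "mps_coeff (elem_sym k) m \<noteq> 0" for m
  proof -
    obtain S where S: "finite S" "card S = k" "(\<Sum>i\<in>S. var i) = m"
      using nz unfolding elem_sym_def mps_coeff_mps_sum
      by (smt (verit) mem_Collect_eq sum.neutral)
    then have "monomial_degree m = (\<Sum>i\<in>S. 1)"
      unfolding monomial_degree_def using keys_sum_var[of S "\<lambda>i. i"] lookup_sum_var[of S]
      by (intro sum.cong) auto
    then show ?thesis using S by simp
  qed
  moreover have "mps_coeff (elem_sym k) (Poly_Mapping.map_key \<sigma> m) = mps_coeff (elem_sym k) m"
    if \<sigma>: "bij \<sigma>" for \<sigma> m
  proof -
    have iff: "(\<Sum>i\<in>S. var i) = Poly_Mapping.map_key \<sigma> m \<longleftrightarrow> (\<Sum>i\<in>\<sigma> ` S. var i) = m"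
      if "finite S" for S
    proof -
      have "(\<Sum>i\<in>S. var i) = Poly_Mapping.map_key \<sigma> (\<Sum>i\<in>\<sigma> ` S. var i)"
        using that \<sigma> by (intro poly_mapping_eqI)
          (simp add: map_key.rep_eq bij_is_inj lookup_sum_var inj_image_mem_iff del: One_nat_def)
      moreover have "Poly_Mapping.map_key \<sigma> a = Poly_Mapping.map_key \<sigma> b \<longleftrightarrow> a = b" for a b :: monomial
        using \<sigma> by (metis bij_is_inj bij_is_surj map_key.rep_eq poly_mapping_eqI surj_f_inv_f comp_apply)
      ultimately show ?thesis by simp
    qed
    have "bij_betw ((`) \<sigma>) {S \<in> {S. finite S \<and> card S = k}. (\<Sum>i\<in>S. var i) = Poly_Mapping.map_key \<sigma> m}
      {S \<in> {S. finite S \<and> card S = k}. (\<Sum>i\<in>S. var i) = m}"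
    proof (rule bij_betw_byWitness[where f' = "(`) (inv \<sigma>)"])
      have inj: "inj \<sigma>" "inj (inv \<sigma>)"
        using \<sigma> by (auto simp: bij_is_inj bij_imp_bij_inv)
      have surj: "\<sigma> ` inv \<sigma> ` S = S" "inv \<sigma> ` \<sigma> ` S = S" for S
        using \<sigma> by (auto simp: bij_is_surj bij_is_inj image_f_inv_f)
      have card: "card (\<sigma> ` S) = card S" "card (inv \<sigma> ` S) = card S" for S
        using inj by (auto intro: card_image inj_on_subset)
      show "(`) \<sigma> ` {S \<in> {S. finite S \<and> card S = k}. (\<Sum>i\<in>S. var i) = Poly_Mapping.map_key \<sigma> m}
        \<subseteq> {S \<in> {S. finite S \<and> card S = k}. (\<Sum>i\<in>S. var i) = m}"
        using iff card by auto
      show "(`) (inv \<sigma>) ` {S \<in> {S. finite S \<and> card S = k}. (\<Sum>i\<in>S. var i) = m}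
        \<subseteq> {S \<in> {S. finite S \<and> card S = k}. (\<Sum>i\<in>S. var i) = Poly_Mapping.map_key \<sigma> m}"
        using iff card surj by auto
    qed (use \<sigma> in \<open>auto simp: bij_is_surj bij_is_inj image_f_inv_f\<close>)
    then show ?thesis
      unfolding elem_sym_def mps_coeff_mps_sum by (simp add: bij_betw_same_card)
  qed
  ultimately show ?thesis
    unfolding symmetric_functions_def by blast
qed

lemma sum_in_symmetric_functions:
  "(\<And>i. i \<in> A \<Longrightarrow> f i \<in> symmetric_functions) \<Longrightarrow> (\<Sum>i\<in>A. f i) \<in> symmetric_functions"
proof (induction A rule: infinite_finite_induct)
  case (insert x A)
  then show ?case by (simp add: symmetric_functions_add)
qed (auto simp: symmetric_functions_def zero_mps.rep_eq)

lemma one_in_symmetric_functions: "(1 :: 'a::comm_ring_1 mps) \<in> symmetric_functions"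
proof -
  have "mps_const 1 = (1 :: 'a mps)"
    by (rule mps_eqI) (simp add: mps_const.rep_eq one_mps.rep_eq)
  then show ?thesis
    using mps_const_in_symmetric_functions[of "1 :: 'a"] by simp
qed

lemma elem_sym_list_in_symmetric_functions: "elem_sym_list \<alpha> \<in> symmetric_functions"
  by (induction \<alpha>) (simp_all add: elem_sym_list_def one_in_symmetric_functions
      symmetric_functions_mult elem_sym_in_symmetric_functions)

section \<open>The value at the empty path\<close>

lemma idempotent_mps_eq_1:
  fixes f :: "'a::comm_ring_1 mps"
  assumes f: "f * f = f" and f0: "mps_coeff f 0 = 1"
  shows "f = 1"
proof -
  define g where "g = f - 1"
  have "g = - (g * g)"
    using f by (simp add: g_def algebra_simps)
  have g: "mps_coeff g m = - (\<Sum>(a, b)\<in>splits m. mps_coeff g a * mps_coeff g b)" for m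
    by (subst \<open>g = - (g * g)\<close>) (simp add: uminus_mps.rep_eq times_mps.rep_eq)
  \<comment> \<open>The equation for \<open>g\<close> expresses a coefficient through products in
    which one factor is the vanishing constant term or belongs to a monomial of smaller
    degree.\<close>
  have "mps_coeff g m = 0" for m
  proof (induction "monomial_degree m" arbitrary: m rule: less_induct)
    case less
    have "mps_coeff g a * mps_coeff g b = 0" if "a + b = m" for a b
    proof (cases "a = 0 \<or> b = 0")
      case True
      moreover have "mps_coeff g 0 = 0"
        by (simp add: g_def minus_mps.rep_eq one_mps.rep_eq f0)
      ultimately show ?thesis by auto
    next
      case False
      then have "monomial_degree a < monomial_degree m"
        using that monomial_degree_0_iff[of b] by (auto simp: monomial_degree_add)
      then show ?thesis using less by simp
    qed
    then show ?case
      by (subst g) (auto simp: splits_def intro!: sum.neutral)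
  qed
  then have "g = 0"
    by (intro mps_eqI) (simp add: zero_mps.rep_eq)
  then show ?thesis by (simp add: g_def)
qed

lemma var_neq_0: "Poly_Mapping.single i (Suc 0) \<noteq> (0 :: monomial)"
  by (metis lookup_single_eq lookup_zero nat.distinct(1))

lemma var_eq_iff: "Poly_Mapping.single i (Suc 0) = Poly_Mapping.single j (Suc 0) \<longleftrightarrow> i = j"
  by (metis lookup_single_eq lookup_single_not_eq nat.distinct(1))

lemma mps_coeff_elem_sym_1: "mps_coeff (elem_sym 1) 0 = 0" "mps_coeff (elem_sym 1) (var i) = 1"
proof -
  have zero: "{S \<in> {S. finite S \<and> card S = 1}. (\<Sum>i\<in>S. var i) = 0} = {}"
    by (auto simp: card_1_singleton_iff var_neq_0)
  show "mps_coeff (elem_sym 1) 0 = 0"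
    unfolding elem_sym_def mps_coeff_mps_sum zero by simp
  have one: "{S \<in> {S. finite S \<and> card S = 1}. (\<Sum>i\<in>S. var i) = var i} = {{i}}"
    by (auto simp: card_1_singleton_iff var_eq_iff)
  show "mps_coeff (elem_sym 1) (var i) = 1"
    unfolding elem_sym_def mps_coeff_mps_sum one by simp
qed

text \<open>The initial values start at \<open>[N, E]\<close>, so the empty path is recovered from
  products: \<open>F []\<close> is idempotent, and \<open>F [] * elem_sym 1 = elem_sym 1\<close>
  forces its constant term to be 1, which excludes the value 0.\<close>

lemma value_empty_path:
  assumes "initial_values F" "multiplicative F"
  shows "F [] = 1"
proof (rule idempotent_mps_eq_1)
  have D: "[] \<in> DYCK" "[N, E] \<in> DYCK"
    by (simp_all add: DYCK_iff_walk)
  show "F [] * F [] = F []"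
    using assms(2) D(1) unfolding multiplicative_def by (metis append_Nil)
  have "compositions 1 = {[1]}"
  proof -
    have "\<alpha> = [1]" if "\<forall>a\<in>set \<alpha>. a > 0" "sum_list \<alpha> = 1" for \<alpha> :: "nat list"
      using that by (cases \<alpha>; cases "tl \<alpha>") auto
    then show ?thesis by (auto simp: compositions_def)
  qed
  moreover have "F [N, E] =
    (\<Sum>\<alpha>\<in>compositions 1. mps_const ((q - 1) ^ (1 - length \<alpha>)) * elem_sym_list \<alpha>)"
    using assms(1) unfolding initial_values_def by (auto dest: spec[of _ 0])
  moreover have "mps_const 1 = (1 :: K mps)"
    by (rule mps_eqI) (simp add: mps_const.rep_eq one_mps.rep_eq)
  ultimately have "F [N, E] = elem_sym 1"
    by (simp add: elem_sym_list_def)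
  moreover have "F [] * F [N, E] = F [N, E]"
    using assms(2) D unfolding multiplicative_def by (metis append_Nil)
  \<comment> \<open>The index 2 is arbitrary. Since \<open>elem_sym 1\<close> has no constant term,
    the coefficient of a single variable in the product sees only the constant term of
    \<open>F []\<close>.\<close>
  ultimately have "mps_coeff (F [] * elem_sym 1) (var 2) = 1"
    using mps_coeff_elem_sym_1(2)[of 2] by simp
  moreover have "mps_coeff (F [] * elem_sym 1) (var 2) = mps_coeff (F []) 0"
  proof -
    have "splits (var 2) = {(0, var 2), (var 2, 0)}"
    proof -
      have "a = 0 \<or> b = 0" if "a + b = var 2" for a b :: monomial
      proof -
        have "monomial_degree a + monomial_degree b = 1"
          unfolding monomial_degree_add[symmetric] that by (simp add: monomial_degree_def)
        then show ?thesis
          by (metis add_is_1 One_nat_def monomial_degree_0_iff)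
      qed
      then show ?thesis by (fastforce simp: splits_def)
    qed
    moreover have "var 2 \<noteq> (0 :: monomial)"
      using var_neq_0 by simp
    ultimately show ?thesis
      by (simp add: times_mps.rep_eq mps_coeff_elem_sym_1 del: One_nat_def)
  qed
  ultimately show "mps_coeff (F []) 0 = 1" by simp
qed

section \<open>Values forced by the relations\<close>

lemma bounce_relationsD_three:
  assumes "bounce_relations F" "P \<in> DYCK" "(x, z) \<in> lattice_points P" "x + 1 < z"
    and "bounce_decomposition P (x, z) (U @ [N]) ([N] @ V @ [N, E]) ([E] @ W)"
  shows "F (U @ [N, N] @ V @ [N, E, E] @ W) =
    mps_const (q + 1) * F (U @ [N, N] @ V @ [E, N, E] @ W)
    - mps_const q * F (U @ [N, N] @ V @ [E, E, N] @ W)"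
  using assms unfolding bounce_relations_def by blast

text \<open>The relation is solved for the path being decomposed, the one of largest
  \<open>E_weight\<close> among the six.\<close>

lemma bounce_relationsD_six:
  assumes "bounce_relations F" "P \<in> DYCK" "(x, z) \<in> lattice_points P" "x + 1 < z"
    and "bounce_decomposition P (x, z) (U @ [N, E]) ([N] @ V @ [N, E]) ([E] @ W)"
  shows "F (U @ [N, E, N] @ V @ [N, E, E] @ W) =
    F (U @ [E, N, N] @ V @ [N, E, E] @ W) + F (U @ [N, E, N] @ V @ [E, E, N] @ W)
      + F (U @ [N, N, E] @ V @ [E, N, E] @ W)
    - F (U @ [E, N, N] @ V @ [E, N, E] @ W) - F (U @ [N, N, E] @ V @ [E, E, N] @ W)"
proof -
  have "F (U @ [E, N, N] @ V @ [E, N, E] @ W) + F (U @ [N, E, N] @ V @ [N, E, E] @ W)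
      + F (U @ [N, N, E] @ V @ [E, E, N] @ W) =
    F (U @ [E, N, N] @ V @ [N, E, E] @ W) + F (U @ [N, E, N] @ V @ [E, E, N] @ W)
      + F (U @ [N, N, E] @ V @ [E, N, E] @ W)"
    using assms unfolding bounce_relations_def by blast
  then show ?thesis by (simp only: algebra_simps)
qed

text \<open>Every case of the bounce induction stays inside the ring generated by scalars and
  elementary symmetric functions. Applied to \<open>LLT\<close>, this yields symmetry without
  permuting colours.\<close>

lemma symmetric_of_relations:
  assumes F: "initial_values F" "multiplicative F" "bounce_relations F" and "P \<in> DYCK"
  shows "F P \<in> \<Lambda>"
  using \<open>P \<in> DYCK\<close>
proof (induction P rule: DYCK_bounce_induct)
  case nil
  show ?case
    by (simp only: value_empty_path[OF F(1,2)] one_in_symmetric_functions)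
next
  case (initial k)
  have "F ([N] @ concat (replicate k [N, E]) @ [E]) =
    (\<Sum>\<alpha>\<in>compositions (k + 1). mps_const ((q - 1) ^ (k + 1 - length \<alpha>)) * elem_sym_list \<alpha>)"
    using F(1) unfolding initial_values_def by blast
  then show ?case
    by (simp only:) (intro sum_in_symmetric_functions symmetric_functions_mult
        mps_const_in_symmetric_functions elem_sym_list_in_symmetric_functions)
next
  case (append P Q)
  then show ?case
    using F(2) unfolding multiplicative_def by (simp add: symmetric_functions_mult)
next
  case (three P x z U V W)
  show ?case
    unfolding bounce_relationsD_three[OF F(3) three(1-4)]
    by (intro symmetric_functions_diff symmetric_functions_mult mps_const_in_symmetric_functions
        three(5,6))
next
  case (six P x z U V W)
  show ?case
    unfolding bounce_relationsD_six[OF F(3) six(1-4)]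
    by (intro symmetric_functions_diff symmetric_functions_add six(5-9))
qed

lemma determined_by_relations:
  assumes F: "initial_values F" "multiplicative F" "bounce_relations F"
    and G: "initial_values G" "multiplicative G" "bounce_relations G" and "P \<in> DYCK"
  shows "F P = G P"
  using \<open>P \<in> DYCK\<close>
proof (induction P rule: DYCK_bounce_induct)
  case nil
  show ?case
    by (simp only: value_empty_path[OF F(1,2)] value_empty_path[OF G(1,2)])
next
  case (initial k)
  show ?case
    using F(1) G(1) unfolding initial_values_def by simp
next
  case (append P Q)
  then show ?case
    using F(2) G(2) unfolding multiplicative_def by simp
next
  case (three P x z U V W)
  show ?case
    unfolding bounce_relationsD_three[OF F(3) three(1-4)] bounce_relationsD_three[OF G(3) three(1-4)]
      three(5,6) ..
next
  case (six P x z U V W)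
  show ?case
    unfolding bounce_relationsD_six[OF F(3) six(1-4)] bounce_relationsD_six[OF G(3) six(1-4)]
      six(5-9) ..
qed

section \<open>The graph of a path\<close>

text \<open>A product over edges instead of a power of a cardinality, so that inserting an edge or
  uniting disjoint finite edge sets multiplies weights.\<close>

definition asc_weight :: "(nat \<times> nat) set \<Rightarrow> (nat \<Rightarrow> nat) \<Rightarrow> K" where
  "asc_weight D \<kappa> = (\<Prod>(x, y)\<in>D. if \<kappa> x < \<kappa> y then q else 1)"

lemma asc_weight_insert:
  "finite D \<Longrightarrow> (x, y) \<notin> D \<Longrightarrow>
    asc_weight (insert (x, y) D) \<kappa> = (if \<kappa> x < \<kappa> y then q else 1) * asc_weight D \<kappa>"
  by (simp add: asc_weight_def)

text \<open>The edge set need not come from a path, so the linear relations can be proved for graphs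
  with twin vertices.\<close>

definition graph_LLT :: "nat \<Rightarrow> (nat \<times> nat) set \<Rightarrow> K mps" where
  "graph_LLT n D = mps_sum (colourings n) (asc_weight D) (\<lambda>\<kappa>. \<Sum>i\<in>{1..n}. var (\<kappa> i))"

lemma asc_weight_eq_power:
  "finite D \<Longrightarrow> asc_weight D \<kappa> = q ^ card {(x, y) \<in> D. \<kappa> x < \<kappa> y}"
proof -
  assume "finite D"
  then have "(\<Prod>p\<in>{p \<in> D. \<kappa> (fst p) < \<kappa> (snd p)}. q) = asc_weight D \<kappa>"
    unfolding asc_weight_def case_prod_beta by (rule prod.inter_filter)
  moreover have "{p \<in> D. \<kappa> (fst p) < \<kappa> (snd p)} = {(x, y) \<in> D. \<kappa> x < \<kappa> y}"
    by auto
  ultimately show ?thesis by simp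
qed

lemma finite_graph_edges: "finite (graph_edges P)"
  by (rule finite_subset[of _ "{..path_size P} \<times> {..path_size P}"]) (auto simp: graph_edges_def)

lemma LLT_eq_graph_LLT: "LLT P = graph_LLT (path_size P) (graph_edges P)"
  by (simp add: LLT_def graph_LLT_def asc_def asc_weight_eq_power[OF finite_graph_edges, abs_def])

text \<open>The pairs of column and height of the east steps of a path that starts at \<open>(i, j)\<close>.\<close>

fun E_steps :: "nat \<Rightarrow> nat \<Rightarrow> path \<Rightarrow> (nat \<times> nat) set" where
  "E_steps i j [] = {}"
| "E_steps i j (N # P) = E_steps i (Suc j) P"
| "E_steps i j (E # P) = insert (Suc i, j) (E_steps (Suc i) j P)"

lemma E_steps_append:
  "E_steps i j (P @ Q) = E_steps i j P \<union> E_steps (i + count_list P E) (j + count_list P N) Q"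
  by (induction i j P rule: E_steps.induct) auto

lemma finite_E_steps [simp]: "finite (E_steps i j P)"
  by (induction i j P rule: E_steps.induct) auto

lemma E_steps_bounds:
  "(x, h) \<in> E_steps i j P \<Longrightarrow> i < x \<and> x \<le> i + count_list P E \<and> j \<le> h \<and> h \<le> j + count_list P N"
  by (induction i j P rule: E_steps.induct) fastforce+

lemma E_steps_iff:
  "(x, h) \<in> E_steps i j P \<longleftrightarrow>
    (\<exists>U W. P = U @ [E] @ W \<and> x = Suc (i + count_list U E) \<and> h = j + count_list U N)"
proof
  show "(x, h) \<in> E_steps i j P \<Longrightarrow>
    \<exists>U W. P = U @ [E] @ W \<and> x = Suc (i + count_list U E) \<and> h = j + count_list U N"
  proof (induction i j P rule: E_steps.induct)
    case (2 i j P)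
    then obtain U W where "P = U @ [E] @ W" "x = Suc (i + count_list U E)" "h = Suc j + count_list U N"
      by auto
    then show ?case by - (rule exI[of _ "N # U"], simp)
  next
    case (3 i j P)
    show ?case
    proof (cases "(x, h) = (Suc i, j)")
      case True
      then show ?thesis by - (rule exI[of _ "[]"], simp)
    next
      case False
      with 3 obtain U W where
        "P = U @ [E] @ W" "x = Suc (Suc i + count_list U E)" "h = j + count_list U N"
        by auto
      then show ?thesis by - (rule exI[of _ "E # U"], simp)
    qed
  qed simp
qed (auto simp: E_steps_append)

text \<open>For \<open>S\<close> the set of east steps of a path, this is the region below the path
  and above the diagonal, recorded column by column.\<close>

definition cells :: "(nat \<times> nat) set \<Rightarrow> (nat \<times> nat) set" where
  "cells S = (\<Union>(x, h)\<in>S. {x} \<times> {x<..h})"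

lemma cells_iff: "(x, y) \<in> cells S \<longleftrightarrow> x < y \<and> (\<exists>h. (x, h) \<in> S \<and> y \<le> h)"
  by (auto simp: cells_def)

lemma cells_Un: "cells (S \<union> T) = cells S \<union> cells T"
  by (auto simp: cells_def)

lemma cells_Suc: "x \<le> h \<Longrightarrow> cells {(x, Suc h)} = insert (x, Suc h) (cells {(x, h)})"
  by (auto simp: cells_def)

lemma finite_cells: "finite S \<Longrightarrow> finite (cells S)"
  by (auto simp: cells_def)

text \<open>Each unit segment is described by coordinates; its parameter is the offset from the
  starting point.\<close>

lemma path_curve_iff:
  "(a, c) \<in> path_curve P \<longleftrightarrow>
    (\<exists>U W. P = U @ [N] @ W \<and> a = real (count_list U E) \<and>
       c \<in> {real (count_list U N)..real (count_list U N) + 1}) \<or>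
    (\<exists>U W. P = U @ [E] @ W \<and> a \<in> {real (count_list U E)..real (count_list U E) + 1} \<and>
       c = real (count_list U N))"
proof -
  have vert: "(a, c) \<in> closed_segment (x, y) (x, y + 1) \<longleftrightarrow> a = x \<and> c \<in> {y..y + 1}" for x y :: real
  proof
    assume "a = x \<and> c \<in> {y..y + 1}"
    then show "(a, c) \<in> closed_segment (x, y) (x, y + 1)"
      unfolding closed_segment_def by (auto intro!: exI[of _ "c - y"] simp: algebra_simps)
  qed (auto simp: closed_segment_def algebra_simps)
  have hor: "(a, c) \<in> closed_segment (x, y) (x + 1, y) \<longleftrightarrow> a \<in> {x..x + 1} \<and> c = y" for x y :: real
  proof
    assume "a \<in> {x..x + 1} \<and> c = y"
    then show "(a, c) \<in> closed_segment (x, y) (x + 1, y)"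
      unfolding closed_segment_def by (auto intro!: exI[of _ "a - x"] simp: algebra_simps)
  qed (auto simp: closed_segment_def algebra_simps)
  have ex_step: "(\<exists>s. \<Phi> s) \<longleftrightarrow> \<Phi> N \<or> \<Phi> E" for \<Phi>
    by (metis step.exhaust)
  have "(a, c) \<in> path_curve P \<longleftrightarrow> (\<exists>U s W. P = U @ [s] @ W \<and>
      (a, c) \<in> closed_segment (plane_point (endpoint U)) (plane_point (endpoint (U @ [s]))))"
    by (auto simp: path_curve_def)
  also have "\<dots> \<longleftrightarrow> (\<exists>U W. P = U @ [N] @ W \<and>
      (a, c) \<in> closed_segment (plane_point (endpoint U)) (plane_point (endpoint (U @ [N])))) \<or>
    (\<exists>U W. P = U @ [E] @ W \<and>
      (a, c) \<in> closed_segment (plane_point (endpoint U)) (plane_point (endpoint (U @ [E]))))"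
    by (simp only: ex_step ex_disj_distrib)
  also have "\<dots> \<longleftrightarrow>
    (\<exists>U W. P = U @ [N] @ W \<and> (a, c) \<in> closed_segment
       (real (count_list U E), real (count_list U N)) (real (count_list U E), real (count_list U N) + 1)) \<or>
    (\<exists>U W. P = U @ [E] @ W \<and> (a, c) \<in> closed_segment
       (real (count_list U E), real (count_list U N)) (real (count_list U E) + 1, real (count_list U N)))"
    by (simp add: plane_point_def endpoint_def add.commute)
  finally show ?thesis
    by (simp only: vert hor)
qed

lemma graph_edges_eq_cells: "graph_edges P = cells (E_steps 0 0 P)"
proof (rule set_eqI, clarify)
  fix x y :: nat
  show "(x, y) \<in> graph_edges P \<longleftrightarrow> (x, y) \<in> cells (E_steps 0 0 P)"
  proof
    assume "(x, y) \<in> graph_edges P"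
    then have xy: "1 \<le> x" "x < y"
      and sub: "{real x - 1..real x} \<times> {real y - 1..real y} \<subseteq> path_region P"
      by (auto simp: graph_edges_def)
    \<comment> \<open>The midpoint of the upper side of the square. Its abscissa is not an integer,
      so the curve above it must belong to an east step.\<close>
    have "(real x - 1 / 2, real y) \<in> path_region P"
      using sub by auto
    then obtain c where c: "real y \<le> c" "(real x - 1 / 2, c) \<in> path_curve P"
      by (auto simp: path_region_def)
    have half: "real x - 1 / 2 \<noteq> real k" for k
    proof
      assume "real x - 1 / 2 = real k"
      then have "real (2 * x) = real (2 * k + 1)" by simp
      then have "2 * x = 2 * k + 1" unfolding of_nat_eq_iff .
      then show False by presburger
    qed
    then obtain U W where U: "P = U @ [E] @ W" "real (count_list U E) \<le> real x - 1 / 2"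
      "real x - 1 / 2 \<le> real (count_list U E) + 1" "c = real (count_list U N)"
      using c(2) unfolding path_curve_iff by auto
    then have "x = Suc (count_list U E)" "y \<le> count_list U N"
      using c(1) by linarith+
    then show "(x, y) \<in> cells (E_steps 0 0 P)"
      unfolding cells_iff E_steps_iff using U(1) xy by auto
  next
    assume "(x, y) \<in> cells (E_steps 0 0 P)"
    then obtain U W where U: "P = U @ [E] @ W" "x = Suc (count_list U E)" "y \<le> count_list U N" "x < y"
      unfolding cells_iff E_steps_iff by auto
    \<comment> \<open>The east step over column \<open>x\<close> bounds the whole square from
      above.\<close>
    have "(a, real (count_list U N)) \<in> path_curve P" if "a \<in> {real x - 1..real x}" for a
      unfolding path_curve_iff using that U by auto
    moreover have "b \<le> real (count_list U N)" "a \<le> b"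
      if "a \<in> {real x - 1..real x}" "b \<in> {real y - 1..real y}" for a b
      using that U by auto
    ultimately have "{real x - 1..real x} \<times> {real y - 1..real y} \<subseteq> path_region P"
      unfolding path_region_def by blast
    then show "(x, y) \<in> graph_edges P"
      using U by (auto simp: graph_edges_def path_size_def)
  qed
qed

section \<open>Bounce relations for LLT polynomials\<close>

lemma mps_sum_add: "mps_sum I f \<mu> + mps_sum I g \<mu> = mps_sum I (\<lambda>i. f i + g i) \<mu>"
  by (rule mps_eqI) (simp add: plus_mps.rep_eq mps_coeff_mps_sum sum.distrib)

lemma mps_sum_diff: "mps_sum I f \<mu> - mps_sum I g \<mu> = mps_sum I (\<lambda>i. f i - g i :: 'a::comm_ring_1) \<mu>"
  by (rule mps_eqI) (simp add: minus_mps.rep_eq mps_coeff_mps_sum sum_subtractf)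

lemma mps_coeff_const_times: "mps_coeff (mps_const c * f) m = c * mps_coeff f m"
proof -
  have "(\<Sum>(a, b)\<in>splits m. mps_coeff (mps_const c) a * mps_coeff f b) =
    (\<Sum>p\<in>{(0 :: monomial, m)}. mps_coeff (mps_const c) (fst p) * mps_coeff f (snd p))"
    unfolding case_prod_beta
    by (rule sum.mono_neutral_right, rule finite_splits) (auto simp: splits_def mps_const.rep_eq)
  then show ?thesis
    by (simp add: times_mps.rep_eq mps_const.rep_eq)
qed

lemma mps_const_times_sum: "mps_const c * mps_sum I f \<mu> = mps_sum I (\<lambda>i. c * f i) \<mu>"
  by (rule mps_eqI) (simp add: mps_coeff_const_times mps_coeff_mps_sum sum_distrib_left)

text \<open>\<open>K\<close> has characteristic 0. This undoes the doubling that comes from adding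
  each sum to its transposed copy.\<close>

lemma K_double_cancel: "a + a = b + b \<Longrightarrow> a = (b :: K)"
proof -
  assume "a + a = b + b"
  then have "(1 + 1) * (a - b) = (0 :: K)"
    by (simp add: algebra_simps)
  moreover have "1 + 1 \<noteq> (0 :: K)"
by (simp add: One_fract_def Zero_fract_def eq_fract)
  ultimately show ?thesis by simp
qed

text \<open>Exchanging the colours of \<open>a\<close> and \<open>b\<close> permutes the colourings
  with a given monomial. Twice each coefficient is therefore a sum of symmetrised weights, which
  agree pointwise.\<close>

lemma sum_colourings_eqI:
  fixes f g :: "(nat \<Rightarrow> nat) \<Rightarrow> K"
  assumes ab: "a \<in> {1..n}" "b \<in> {1..n}"
    and eq: "\<And>\<kappa>. f \<kappa> + f (\<kappa> \<circ> Transposition.transpose a b) = g \<kappa> + g (\<kappa> \<circ> Transposition.transpose a b)"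
  shows "mps_sum (colourings n) f (\<lambda>\<kappa>. \<Sum>i\<in>{1..n}. var (\<kappa> i)) =
    mps_sum (colourings n) g (\<lambda>\<kappa>. \<Sum>i\<in>{1..n}. var (\<kappa> i))"
proof (rule mps_eqI)
  fix m
  define A where "A = {\<kappa> \<in> colourings n. (\<Sum>i\<in>{1..n}. var (\<kappa> i)) = m}"
  have closed: "\<kappa> \<circ> Transposition.transpose a b \<in> A" if "\<kappa> \<in> A" for \<kappa>
  proof -
    have "Transposition.transpose a b permutes {1..n}"
      using ab by (rule permutes_swap_id)
    then have "(\<Sum>i\<in>{1..n}. var (\<kappa> i)) = (\<Sum>i\<in>{1..n}. var ((\<kappa> \<circ> Transposition.transpose a b) i))"
      using sum.permute[of "Transposition.transpose a b" "{1..n}" "\<lambda>i. var (\<kappa> i)"] by (simp add: o_def)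
    moreover have "\<kappa> \<circ> Transposition.transpose a b \<in> colourings n"
      using that ab by (auto simp: A_def colourings_def PiE_def extensional_def Transposition.transpose_def)
    ultimately show ?thesis
      using that by (simp add: A_def)
  qed
  have swap: "(\<Sum>\<kappa>\<in>A. h (\<kappa> \<circ> Transposition.transpose a b)) = (\<Sum>\<kappa>\<in>A. h \<kappa>)" for h :: "_ \<Rightarrow> K"
    by (rule sum.reindex_bij_witness[where i = "\<lambda>\<kappa>. \<kappa> \<circ> Transposition.transpose a b" and j = "\<lambda>\<kappa>. \<kappa> \<circ> Transposition.transpose a b"])
      (auto simp: closed comp_assoc)
  have "(\<Sum>\<kappa>\<in>A. f \<kappa>) + (\<Sum>\<kappa>\<in>A. f \<kappa>) = (\<Sum>\<kappa>\<in>A. f \<kappa> + f (\<kappa> \<circ> Transposition.transpose a b))"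
    by (simp add: sum.distrib swap)
  also have "\<dots> = (\<Sum>\<kappa>\<in>A. g \<kappa>) + (\<Sum>\<kappa>\<in>A. g \<kappa>)"
    by (simp add: eq sum.distrib swap)
  finally have "(\<Sum>\<kappa>\<in>A. f \<kappa>) = (\<Sum>\<kappa>\<in>A. g \<kappa>)"
    by (rule K_double_cancel)
  then show "mps_coeff (mps_sum (colourings n) f (\<lambda>\<kappa>. \<Sum>i\<in>{1..n}. var (\<kappa> i))) m =
    mps_coeff (mps_sum (colourings n) g (\<lambda>\<kappa>. \<Sum>i\<in>{1..n}. var (\<kappa> i))) m"
    by (simp add: mps_coeff_mps_sum A_def)
qed

text \<open>Edges are ordered pairs, so the reversed edge and the loops are excluded explicitly. The
  conditions make \<open>D - {(a, b)}\<close> invariant under exchanging \<open>a\<close> and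
  \<open>b\<close>.\<close>

definition twins :: "(nat \<times> nat) set \<Rightarrow> nat \<Rightarrow> nat \<Rightarrow> bool" where
  "twins D a b \<longleftrightarrow> finite D \<and> (a, b) \<in> D \<and> (b, a) \<notin> D \<and>
     (\<forall>c. c \<noteq> a \<longrightarrow> c \<noteq> b \<longrightarrow> ((a, c) \<in> D \<longleftrightarrow> (b, c) \<in> D) \<and> ((c, a) \<in> D \<longleftrightarrow> (c, b) \<in> D)) \<and>
     (a, a) \<notin> D \<and> (b, b) \<notin> D"

text \<open>Here \<open>r\<close> is the weight of all edges other than \<open>(a, b)\<close>; the
  exchange of the twins merely permutes these edges.\<close>

lemma asc_weight_twins:
  assumes "twins D a b"
  obtains r where
    "\<And>\<kappa>. asc_weight D \<kappa> = (if \<kappa> a < \<kappa> b then q else 1) * r \<kappa>"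
    "\<And>\<kappa>. r (\<kappa> \<circ> Transposition.transpose a b) = r \<kappa>"
proof
  define D' where "D' = D - {(a, b)}"
  show "asc_weight D \<kappa> = (if \<kappa> a < \<kappa> b then q else 1) * asc_weight D' \<kappa>" for \<kappa>
    using assms asc_weight_insert[of D' a b \<kappa>] by (simp add: D'_def twins_def insert_absorb)
  have inv: "map_prod (Transposition.transpose a b) (Transposition.transpose a b) p \<in> D'" if "p \<in> D'" for p
  proof (cases p)
    case (Pair x y)
    have D: "(x, y) \<in> D" "(x, y) \<noteq> (a, b)" "(b, a) \<notin> D" "(a, a) \<notin> D" "(b, b) \<notin> D"
      and iff: "\<And>c. c \<noteq> a \<Longrightarrow> c \<noteq> b \<Longrightarrow> (a, c) \<in> D \<longleftrightarrow> (b, c) \<in> D"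
        "\<And>c. c \<noteq> a \<Longrightarrow> c \<noteq> b \<Longrightarrow> (c, a) \<in> D \<longleftrightarrow> (c, b) \<in> D"
      using assms that Pair by (auto simp: D'_def twins_def)
    consider "x = a" | "x = b" | "y = a" "x \<noteq> a" "x \<noteq> b" | "y = b" "x \<noteq> a" "x \<noteq> b"
      | "x \<noteq> a" "x \<noteq> b" "y \<noteq> a" "y \<noteq> b"
      by blast
    then show ?thesis
      by cases (use D iff[of x] iff[of y] Pair in
          \<open>cases "y = a"; cases "y = b"; force simp: D'_def\<close>)+
  qed
  show "asc_weight D' (\<kappa> \<circ> Transposition.transpose a b) = asc_weight D' \<kappa>" for \<kappa>
    unfolding asc_weight_def
    by (rule prod.reindex_bij_witness[where i = "map_prod (Transposition.transpose a b) (Transposition.transpose a b)"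
          and j = "map_prod (Transposition.transpose a b) (Transposition.transpose a b)"])
      (use inv in \<open>auto simp: map_prod_def\<close>)
qed

text \<open>With the invariant factor \<open>r\<close> taken out, \<open>(a, b)\<close> contributes
  \<open>q\<close> to one of the two colourings and 1 to the other if the colours of
  \<open>a\<close> and \<open>b\<close> differ. What remains depends on which of these colours lie
  below that of \<open>z\<close>, and the smaller one does whenever the larger one does.\<close>

lemma graph_LLT_three_term:
  assumes D: "twins D a b" and ab: "a \<in> {1..n}" "b \<in> {1..n}"
    and z: "z \<noteq> a" "z \<noteq> b" "(a, z) \<notin> D" "(b, z) \<notin> D"
  shows "graph_LLT n (insert (a, z) (insert (b, z) D)) =
    mps_const (q + 1) * graph_LLT n (insert (b, z) D) - mps_const q * graph_LLT n D"
proof -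
  obtain r where r: "\<And>\<kappa>. asc_weight D \<kappa> = (if \<kappa> a < \<kappa> b then q else 1) * r \<kappa>"
    "\<And>\<kappa>. r (\<kappa> \<circ> Transposition.transpose a b) = r \<kappa>"
    using asc_weight_twins[OF D] by blast
  have "a \<noteq> b" "finite D"
    using D by (auto simp: twins_def)
  then have w1: "asc_weight (insert (b, z) D) \<kappa> = (if \<kappa> b < \<kappa> z then q else 1) * asc_weight D \<kappa>"
    and w2: "asc_weight (insert (a, z) (insert (b, z) D)) \<kappa> =
      (if \<kappa> a < \<kappa> z then q else 1) * (if \<kappa> b < \<kappa> z then q else 1) * asc_weight D \<kappa>" for \<kappa>
    using z by (simp_all add: asc_weight_insert)
  show ?thesis
    unfolding graph_LLT_def mps_const_times_sum mps_sum_diff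
  proof (rule sum_colourings_eqI[OF ab])
    fix \<kappa> :: "nat \<Rightarrow> nat"
    have \<tau>: "Transposition.transpose a b a = b" "Transposition.transpose a b b = a" "Transposition.transpose a b z = z"
      using z by simp_all
    consider "\<kappa> a = \<kappa> b" | "\<kappa> a < \<kappa> b" | "\<kappa> b < \<kappa> a"
      by linarith
    then show "asc_weight (insert (a, z) (insert (b, z) D)) \<kappa> +
        asc_weight (insert (a, z) (insert (b, z) D)) (\<kappa> \<circ> Transposition.transpose a b) =
      (q + 1) * asc_weight (insert (b, z) D) \<kappa> - q * asc_weight D \<kappa> +
      ((q + 1) * asc_weight (insert (b, z) D) (\<kappa> \<circ> Transposition.transpose a b) -
        q * asc_weight D (\<kappa> \<circ> Transposition.transpose a b))"
      unfolding w1 w2 r o_apply \<tau>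
      by cases (cases "\<kappa> a < \<kappa> z"; cases "\<kappa> b < \<kappa> z"; simp add: algebra_simps)+
  qed
qed

text \<open>Here \<open>c\<close>, \<open>d\<close>, \<open>g\<close>, \<open>z\<close> are the
  colours of \<open>a\<close>, \<open>b\<close>, \<open>g\<close>, \<open>z\<close> and
  \<open>r\<close> is the invariant factor. On each side the second line is the first one with
  \<open>c\<close> and \<open>d\<close> exchanged.\<close>

lemma six_term_weights:
  fixes c d g z :: nat and r :: K
  defines "v i j \<equiv> if i < j then q else 1 :: K"
  shows "v d z * (v c d * r) + v g c * v c z * v d z * (v c d * r) + v g c * v g d * (v c d * r) +
    (v c z * (v d c * r) + v g d * v d z * v c z * (v d c * r) + v g d * v g c * (v d c * r)) =
    v c z * v d z * (v c d * r) + v g c * (v c d * r) + v g c * v g d * v d z * (v c d * r) +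
    (v d z * v c z * (v d c * r) + v g d * (v d c * r) + v g d * v g c * v c z * (v d c * r))"
proof -
  consider "c = d" | "c < d" | "d < c"
    by linarith
  then show ?thesis
    by cases (cases "c < z"; cases "d < z"; cases "g < c"; cases "g < d"; simp add: v_def algebra_simps)+
qed

lemma graph_LLT_six_term:
  assumes D: "twins D a b" and ab: "a \<in> {1..n}" "b \<in> {1..n}"
    and z: "z \<noteq> a" "z \<noteq> b" "(a, z) \<notin> D" "(b, z) \<notin> D"
    and g: "g \<noteq> a" "g \<noteq> b" "(g, a) \<notin> D" "(g, b) \<notin> D"
  shows "graph_LLT n (insert (b, z) D) +
      graph_LLT n (insert (g, a) (insert (a, z) (insert (b, z) D))) +
      graph_LLT n (insert (g, a) (insert (g, b) D)) =
    graph_LLT n (insert (a, z) (insert (b, z) D)) + graph_LLT n (insert (g, a) D) +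
      graph_LLT n (insert (g, a) (insert (g, b) (insert (b, z) D)))"
proof -
  obtain r where r: "\<And>\<kappa>. asc_weight D \<kappa> = (if \<kappa> a < \<kappa> b then q else 1) * r \<kappa>"
    "\<And>\<kappa>. r (\<kappa> \<circ> Transposition.transpose a b) = r \<kappa>"
    using asc_weight_twins[OF D] by blast
  have "a \<noteq> b" "finite D"
    using D by (auto simp: twins_def)
  then have w: "asc_weight (insert (b, z) D) \<kappa> = (if \<kappa> b < \<kappa> z then q else 1) * asc_weight D \<kappa>"
    "asc_weight (insert (a, z) (insert (b, z) D)) \<kappa> =
      (if \<kappa> a < \<kappa> z then q else 1) * (if \<kappa> b < \<kappa> z then q else 1) * asc_weight D \<kappa>"
    "asc_weight (insert (g, a) D) \<kappa> = (if \<kappa> g < \<kappa> a then q else 1) * asc_weight D \<kappa>"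
    "asc_weight (insert (g, a) (insert (g, b) D)) \<kappa> =
      (if \<kappa> g < \<kappa> a then q else 1) * (if \<kappa> g < \<kappa> b then q else 1) * asc_weight D \<kappa>"
    "asc_weight (insert (g, a) (insert (g, b) (insert (b, z) D))) \<kappa> =
      (if \<kappa> g < \<kappa> a then q else 1) * (if \<kappa> g < \<kappa> b then q else 1) *
      (if \<kappa> b < \<kappa> z then q else 1) * asc_weight D \<kappa>"
    "asc_weight (insert (g, a) (insert (a, z) (insert (b, z) D))) \<kappa> =
      (if \<kappa> g < \<kappa> a then q else 1) *
      (if \<kappa> a < \<kappa> z then q else 1) * (if \<kappa> b < \<kappa> z then q else 1) * asc_weight D \<kappa>" for \<kappa>
    using z g by (simp_all add: asc_weight_insert)
  show ?thesis
    unfolding graph_LLT_def mps_sum_add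
  proof (rule sum_colourings_eqI[OF ab], goal_cases)
    case (1 \<kappa>)
    have \<tau>: "Transposition.transpose a b a = b" "Transposition.transpose a b b = a" "Transposition.transpose a b z = z" "Transposition.transpose a b g = g"
      using z g by simp_all
    show ?case
      unfolding w r o_apply \<tau>
      using six_term_weights[where c = "\<kappa> a" and d = "\<kappa> b" and z = "\<kappa> z" and g = "\<kappa> g" and r = "r \<kappa>"] by (simp only: mult.assoc)
  qed
qed

text \<open>Columns \<open>a\<close> and \<open>Suc a\<close> both end at height \<open>m\<close>,
  so they have the same upper neighbours. No column to the left ends at height exactly
  \<open>a\<close>, so each of them reaches both vertices or neither. Columns to the right
  contribute no edge at either vertex.\<close>

lemma twins_cells:
  assumes "finite SL" "finite SR" "a < m"
    and SL: "\<And>c h. (c, h) \<in> SL \<Longrightarrow> c < a \<and> h \<noteq> a"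
    and SR: "\<And>c h. (c, h) \<in> SR \<Longrightarrow> Suc a < c"
  defines "D \<equiv> cells (SL \<union> {(a, m), (Suc a, m)} \<union> SR)"
  shows "twins D a (Suc a)" "(a, Suc m) \<notin> D" "(Suc a, Suc m) \<notin> D"
proof -
  have row: "(a, c) \<in> D \<longleftrightarrow> a < c \<and> c \<le> m" "(Suc a, c) \<in> D \<longleftrightarrow> Suc a < c \<and> c \<le> m" for c
    using SL SR unfolding D_def cells_iff by fastforce+
  have col: "(c, a) \<in> D \<longleftrightarrow> (\<exists>h. (c, h) \<in> SL \<and> a < h)"
    "c \<noteq> a \<Longrightarrow> (c, Suc a) \<in> D \<longleftrightarrow> (\<exists>h. (c, h) \<in> SL \<and> a < h)" for c
    using SL SR unfolding D_def cells_iff by (fastforce simp: Suc_le_eq le_less)+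
  have "finite D"
    unfolding D_def using assms by (intro finite_cells) simp
  then show "twins D a (Suc a)"
    unfolding twins_def using row col \<open>a < m\<close> by (auto dest: SL)
  show "(a, Suc m) \<notin> D" "(Suc a, Suc m) \<notin> D"
    using row by auto
qed

lemma LLT_eq: "LLT P = graph_LLT (count_list P N) (cells (E_steps 0 0 P))"
  by (simp add: LLT_eq_graph_LLT graph_edges_eq_cells path_size_def)

text \<open>The last block carries the east steps over columns \<open>a\<close> and
  \<open>Suc a\<close>. The path with \<open>[E, E, N]\<close> gives the twin graph
  \<open>D\<close>, and raising these steps adds the edges to \<open>Suc m\<close>.\<close>

lemma LLT_three_term:
  assumes "count_list U N = count_list U E + count_list V E"
  shows "LLT (U @ [N, N] @ V @ [N, E, E] @ W) =
    mps_const (q + 1) * LLT (U @ [N, N] @ V @ [E, N, E] @ W)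
    - mps_const q * LLT (U @ [N, N] @ V @ [E, E, N] @ W)"
proof -
  \<comment> \<open>By the count equation \<open>a\<close> is also the column of the first east step
    in the last block; \<open>m\<close> is the height at which that block starts.\<close>
  define a where "a = Suc (count_list U N)"
  define m where "m = Suc (a + count_list V N)"
  define SL where "SL = E_steps 0 0 U \<union> E_steps (count_list U E) (Suc a) V"
  define SR where "SR = E_steps (Suc a) (Suc m) W"
  define S where "S = (\<lambda>h h'. SL \<union> {(a, h), (Suc a, h')} \<union> SR)"
  define D where "D = cells (S m m)"
  define n where "n = count_list (U @ [N, N] @ V @ [N, E, E] @ W) N"
  \<comment> \<open>East steps of \<open>U\<close> lie below height \<open>a\<close> and those of
    \<open>V\<close> above it, because \<open>[N, N]\<close> passes this height without an east
    step.\<close>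
  have SL: "c < a \<and> h \<noteq> a" if "(c, h) \<in> SL" for c h
    using that assms E_steps_bounds[of c h] by (fastforce simp: SL_def a_def)
  have SR: "Suc a < c" if "(c, h) \<in> SR" for c h
    using that E_steps_bounds by (fastforce simp: SR_def)
  have "a < m" by (simp add: m_def)
  have D: "twins D a (Suc a)" "(a, Suc m) \<notin> D" "(Suc a, Suc m) \<notin> D"
    unfolding D_def S_def using SL SR \<open>a < m\<close>
    by (intro twins_cells; simp add: SL_def SR_def)+
  have LLT: "LLT (U @ [N, N] @ V @ Y @ W) = graph_LLT n (cells (S h h'))"
    if "(Y, h, h') \<in> {([E, E, N], m, m), ([E, N, E], m, Suc m), ([N, E, E], Suc m, Suc m)}" for Y h h'
    unfolding LLT_eq
  proof (rule arg_cong2[of _ _ _ _ graph_LLT])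
    show "count_list (U @ [N, N] @ V @ Y @ W) N = n"
      using that by (auto simp: n_def)
    have "E_steps 0 0 (U @ [N, N] @ V @ Y @ W) = S h h'"
      using that assms by (auto simp: S_def SL_def SR_def E_steps_append a_def m_def)
    then show "cells (E_steps 0 0 (U @ [N, N] @ V @ Y @ W)) = cells (S h h')"
      by simp
  qed
  have cells: "cells (S m (Suc m)) = insert (Suc a, Suc m) D"
    "cells (S (Suc m) (Suc m)) = insert (a, Suc m) (insert (Suc a, Suc m) D)"
    using \<open>a < m\<close> by (auto simp: D_def S_def cells_def)
  have "a \<in> {1..n}" "Suc a \<in> {1..n}" "Suc m \<noteq> a" "Suc m \<noteq> Suc a"
    by (simp_all add: a_def m_def n_def)
  then have "graph_LLT n (cells (S (Suc m) (Suc m))) =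
    mps_const (q + 1) * graph_LLT n (cells (S m (Suc m))) - mps_const q * graph_LLT n (cells (S m m))"
    unfolding cells D_def[symmetric] using D by (intro graph_LLT_three_term) auto
  moreover have "LLT (U @ [N, N] @ V @ [N, E, E] @ W) = graph_LLT n (cells (S (Suc m) (Suc m)))"
    "LLT (U @ [N, N] @ V @ [E, N, E] @ W) = graph_LLT n (cells (S m (Suc m)))"
    "LLT (U @ [N, N] @ V @ [E, E, N] @ W) = graph_LLT n (cells (S m m))"
    by (rule LLT; simp)+
  ultimately show ?thesis
    by (simp only:)
qed

text \<open>The first varying block has one east step, over column \<open>g\<close>; its height
  decides whether \<open>g\<close> is joined to \<open>a\<close> and to \<open>Suc a\<close>. The
  last block decides in the same way about the edges to \<open>Suc m\<close>.\<close>

lemma LLT_six_term: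
  assumes "count_list U N = Suc (count_list U E + count_list V E)"
  shows "LLT (U @ [E, N, N] @ V @ [E, N, E] @ W)
      + LLT (U @ [N, E, N] @ V @ [N, E, E] @ W)
      + LLT (U @ [N, N, E] @ V @ [E, E, N] @ W) =
    LLT (U @ [E, N, N] @ V @ [N, E, E] @ W)
      + LLT (U @ [N, E, N] @ V @ [E, E, N] @ W)
      + LLT (U @ [N, N, E] @ V @ [E, N, E] @ W)"
proof -
  define g where "g = Suc (count_list U E)"
  define a where "a = Suc (count_list U N)"
  define m where "m = Suc (a + count_list V N)"
  define SL where "SL = (\<lambda>k. E_steps 0 0 U \<union> {(g, k)} \<union> E_steps g (Suc a) V)"
  define SR where "SR = E_steps (Suc a) (Suc m) W"
  define S where "S = (\<lambda>k h h'. SL k \<union> {(a, h), (Suc a, h')} \<union> SR)"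
  define D where "D = cells (S (count_list U N) m m)"
  define n where "n = count_list (U @ [E, N, N] @ V @ [N, E, E] @ W) N"
  have gam: "g < a" "a < m"
    using assms by (simp_all add: g_def a_def m_def)
  have SL: "c < a \<and> h \<noteq> a" if "(c, h) \<in> SL (count_list U N)" for c h
    using that assms E_steps_bounds[of c h] by (fastforce simp: SL_def g_def a_def)
  have SR: "Suc a < c" if "(c, h) \<in> SR" for c h
    using that E_steps_bounds by (fastforce simp: SR_def)
  have D: "twins D a (Suc a)" "(a, Suc m) \<notin> D" "(Suc a, Suc m) \<notin> D"
    unfolding D_def S_def using SL SR gam
    by (intro twins_cells; simp add: SL_def SR_def)+
  \<comment> \<open>In \<open>D\<close> column \<open>g\<close> stops just below height
    \<open>a\<close>, so neither of its varying edges is present.\<close>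
  have g: "(g, y) \<notin> D" if "y \<ge> a" for y
  proof
    assume "(g, y) \<in> D"
    then obtain h where h: "(g, h) \<in> S (count_list U N) m m" "y \<le> h"
      by (auto simp: D_def cells_iff)
    from h(1) have "h = count_list U N"
      using gam SR E_steps_bounds[of g h] by (fastforce simp: S_def SL_def g_def)
    then show False
      using h(2) that by (simp add: a_def)
  qed
  have LLT: "LLT (U @ X @ V @ Y @ W) = graph_LLT n (cells (S k h h'))"
    if "(X, k) \<in> {([E, N, N], count_list U N), ([N, E, N], a), ([N, N, E], Suc a)}"
      "(Y, h, h') \<in> {([E, E, N], m, m), ([E, N, E], m, Suc m), ([N, E, E], Suc m, Suc m)}" for X Y k h h'
    unfolding LLT_eq
  proof (rule arg_cong2[of _ _ _ _ graph_LLT])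
    show "count_list (U @ X @ V @ Y @ W) N = n"
      using that by (auto simp: n_def)
    have "E_steps 0 0 (U @ X @ V @ Y @ W) = S k h h'"
      using that assms by (auto simp: S_def SL_def SR_def E_steps_append a_def g_def m_def)
    then show "cells (E_steps 0 0 (U @ X @ V @ Y @ W)) = cells (S k h h')"
      by simp
  qed
  \<comment> \<open>Columns contribute independently, so raising one of the varying steps by one
    unit adds a single cell.\<close>
  have cells_S: "cells (S k h h') = cells {(g, k)} \<union> cells {(a, h)} \<union> cells {(Suc a, h')} \<union>
    (cells (E_steps 0 0 U) \<union> cells (E_steps g (Suc a) V) \<union> cells SR)" for k h h'
    unfolding S_def SL_def by (simp add: cells_def Un_ac)
  have cells_Suc': "cells {(g, a)} = insert (g, a) (cells {(g, count_list U N)})"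
    "cells {(g, Suc a)} = insert (g, Suc a) (cells {(g, a)})"
    "cells {(a, Suc m)} = insert (a, Suc m) (cells {(a, m)})"
    "cells {(Suc a, Suc m)} = insert (Suc a, Suc m) (cells {(Suc a, m)})"
    using gam cells_Suc[of g "count_list U N"] by (simp_all add: cells_Suc a_def)
  have cells: "cells (S (count_list U N) m (Suc m)) = insert (Suc a, Suc m) D"
    "cells (S (count_list U N) (Suc m) (Suc m)) = insert (a, Suc m) (insert (Suc a, Suc m) D)"
    "cells (S a m m) = insert (g, a) D"
    "cells (S a (Suc m) (Suc m)) = insert (g, a) (insert (a, Suc m) (insert (Suc a, Suc m) D))"
    "cells (S (Suc a) m m) = insert (g, a) (insert (g, Suc a) D)"
    "cells (S (Suc a) m (Suc m)) = insert (g, a) (insert (g, Suc a) (insert (Suc a, Suc m) D))"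
    unfolding D_def cells_S cells_Suc' by (simp_all add: insert_commute)
  have "a \<in> {1..n}" "Suc a \<in> {1..n}" "Suc m \<noteq> a" "Suc m \<noteq> Suc a" "g \<noteq> a" "g \<noteq> Suc a"
    using gam by (simp_all add: a_def m_def n_def)
  then have "graph_LLT n (cells (S (count_list U N) m (Suc m)))
      + graph_LLT n (cells (S a (Suc m) (Suc m))) + graph_LLT n (cells (S (Suc a) m m)) =
    graph_LLT n (cells (S (count_list U N) (Suc m) (Suc m)))
      + graph_LLT n (cells (S a m m)) + graph_LLT n (cells (S (Suc a) m (Suc m)))"
    unfolding cells using D g by (intro graph_LLT_six_term) auto
  moreover have "LLT (U @ [E, N, N] @ V @ [E, N, E] @ W) = graph_LLT n (cells (S (count_list U N) m (Suc m)))"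
    "LLT (U @ [N, E, N] @ V @ [N, E, E] @ W) = graph_LLT n (cells (S a (Suc m) (Suc m)))"
    "LLT (U @ [N, N, E] @ V @ [E, E, N] @ W) = graph_LLT n (cells (S (Suc a) m m))"
    "LLT (U @ [E, N, N] @ V @ [N, E, E] @ W) = graph_LLT n (cells (S (count_list U N) (Suc m) (Suc m)))"
    "LLT (U @ [N, E, N] @ V @ [E, E, N] @ W) = graph_LLT n (cells (S a m m))"
    "LLT (U @ [N, N, E] @ V @ [E, N, E] @ W) = graph_LLT n (cells (S (Suc a) m (Suc m)))"
    by (rule LLT; simp)+
  ultimately show ?thesis
    by (simp only:)
qed

lemma bounce_relations_LLT: "bounce_relations LLT"
  unfolding bounce_relations_def
proof (intro ballI allI impI conjI)
  fix P x z U V W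
  assume "bounce_decomposition P (x, z) (U @ [N]) ([N] @ V @ [N, E]) ([E] @ W)"
  then have "count_list (U @ [N]) N = x" "count_list ((U @ [N]) @ [N] @ V @ [N, E]) E = x"
    by (rule bounce_decompositionD)+
  then have "count_list U N = count_list U E + count_list V E" by simp
  then show "LLT (U @ [N, N] @ V @ [N, E, E] @ W) =
      mps_const (q + 1) * LLT (U @ [N, N] @ V @ [E, N, E] @ W)
      - mps_const q * LLT (U @ [N, N] @ V @ [E, E, N] @ W)"
    by (rule LLT_three_term)
next
  fix P x z U V W
  assume "bounce_decomposition P (x, z) (U @ [N, E]) ([N] @ V @ [N, E]) ([E] @ W)"
  then have "count_list (U @ [N, E]) N = x" "count_list ((U @ [N, E]) @ [N] @ V @ [N, E]) E = x"
    by (rule bounce_decompositionD)+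
  then have "count_list U N = Suc (count_list U E + count_list V E)" by simp
  then show "LLT (U @ [E, N, N] @ V @ [E, N, E] @ W)
      + LLT (U @ [N, E, N] @ V @ [N, E, E] @ W)
      + LLT (U @ [N, N, E] @ V @ [E, E, N] @ W) =
    LLT (U @ [E, N, N] @ V @ [N, E, E] @ W)
      + LLT (U @ [N, E, N] @ V @ [E, E, N] @ W)
      + LLT (U @ [N, N, E] @ V @ [E, N, E] @ W)"
    by (rule LLT_six_term)
qed

section \<open>Products and initial values of LLT polynomials\<close>

lemma mps_sum_reindex:
  assumes "bij_betw f J I" "\<And>j. j \<in> J \<Longrightarrow> c' j = c (f j)" "\<And>j. j \<in> J \<Longrightarrow> \<mu>' j = \<mu> (f j)"
  shows "mps_sum J c' \<mu>' = mps_sum I c \<mu>"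
proof (rule mps_eqI)
  fix m
  have "bij_betw f {j \<in> J. \<mu>' j = m} {i \<in> I. \<mu> i = m}"
    using assms(1,3) unfolding bij_betw_def inj_on_def by auto
  then have "(\<Sum>j\<in>{j \<in> J. \<mu>' j = m}. c (f j)) = (\<Sum>i\<in>{i \<in> I. \<mu> i = m}. c i)"
    by (rule sum.reindex_bij_betw)
  then show "mps_coeff (mps_sum J c' \<mu>') m = mps_coeff (mps_sum I c \<mu>) m"
    by (simp add: mps_coeff_mps_sum assms(2))
qed

lemma mps_sum_times:
  fixes c :: "'i \<Rightarrow> 'a::comm_ring_1"
  assumes "\<And>m. finite {i \<in> I. \<mu> i = m}" "\<And>m. finite {j \<in> J. \<nu> j = m}"
  shows "mps_sum I c \<mu> * mps_sum J d \<nu> = mps_sum (I \<times> J) (\<lambda>(i, j). c i * d j) (\<lambda>(i, j). \<mu> i + \<nu> j)"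
proof (rule mps_eqI)
  fix m
  let ?I = "\<lambda>a. {i \<in> I. \<mu> i = a}" and ?J = "\<lambda>b. {j \<in> J. \<nu> j = b}"
  have "mps_coeff (mps_sum I c \<mu> * mps_sum J d \<nu>) m =
    (\<Sum>p\<in>splits m. \<Sum>r\<in>?I (fst p) \<times> ?J (snd p). c (fst r) * d (snd r))"
    by (simp add: times_mps.rep_eq mps_coeff_mps_sum sum_product sum.cartesian_product case_prod_beta)
  also have "\<dots> = (\<Sum>(p, r)\<in>Sigma (splits m) (\<lambda>p. ?I (fst p) \<times> ?J (snd p)). c (fst r) * d (snd r))"
    by (rule sum.Sigma) (use assms in auto)
  also have "\<dots> = (\<Sum>r\<in>{r \<in> I \<times> J. (case r of (i, j) \<Rightarrow> \<mu> i + \<nu> j) = m}. case r of (i, j) \<Rightarrow> c i * d j)"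
    by (rule sum.reindex_bij_witness[where i = "\<lambda>(i, j). ((\<mu> i, \<nu> j), (i, j))" and j = snd])
      (auto simp: splits_def)
  also have "\<dots> = mps_coeff (mps_sum (I \<times> J) (\<lambda>(i, j). c i * d j) (\<lambda>(i, j). \<mu> i + \<nu> j)) m"
    by (simp add: mps_coeff_mps_sum)
  finally show "mps_coeff (mps_sum I c \<mu> * mps_sum J d \<nu>) m =
    mps_coeff (mps_sum (I \<times> J) (\<lambda>(i, j). c i * d j) (\<lambda>(i, j). \<mu> i + \<nu> j)) m" .
qed

lemma mps_sum_filter:
  assumes "\<And>m. finite {i \<in> I. \<mu> i = m}"
  shows "mps_sum {i \<in> I. \<Phi> i} c \<mu> = mps_sum I (\<lambda>i. if \<Phi> i then c i else 0) \<mu>"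
proof (rule mps_eqI)
  fix m
  have "(\<Sum>i\<in>{i \<in> {i \<in> I. \<mu> i = m}. \<Phi> i}. c i) = (\<Sum>i\<in>{i \<in> I. \<mu> i = m}. if \<Phi> i then c i else 0)"
    using assms by (rule sum.inter_filter)
  moreover have "{i \<in> {i \<in> I. \<mu> i = m}. \<Phi> i} = {i \<in> {i \<in> I. \<Phi> i}. \<mu> i = m}"
    by auto
  ultimately show "mps_coeff (mps_sum {i \<in> I. \<Phi> i} c \<mu>) m =
    mps_coeff (mps_sum I (\<lambda>i. if \<Phi> i then c i else 0) \<mu>) m"
    by (simp add: mps_coeff_mps_sum)
qed

lemma mps_coeff_sum: "mps_coeff (\<Sum>j\<in>A. f j) m = (\<Sum>j\<in>A. mps_coeff (f j) m :: 'a::comm_ring_1)"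
  by (induction A rule: infinite_finite_induct) (simp_all add: zero_mps.rep_eq plus_mps.rep_eq)

lemma sum_mps_sum: "(\<Sum>j\<in>A. mps_sum I (f j) \<mu>) = mps_sum I (\<lambda>i. \<Sum>j\<in>A. f j i :: 'a::comm_ring_1) \<mu>"
  by (rule mps_eqI) (simp add: mps_coeff_sum mps_coeff_mps_sum sum.swap[of _ _ A])

section \<open>Series over words of fixed length\<close>

definition list_series :: "nat \<Rightarrow> (nat list \<Rightarrow> 'a::comm_ring_1) \<Rightarrow> 'a mps" where
  "list_series n w = mps_sum {l. length l = n} w (\<lambda>l. \<Sum>c\<leftarrow>l. var c)"

lemma keys_sum_list_var: "Poly_Mapping.keys (\<Sum>c\<leftarrow>l. var c) = set l"
  by (induction l) (simp_all add: keys_add_monomial)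

lemma finite_list_fibre: "finite {l \<in> {l. length l = n}. (\<Sum>c\<leftarrow>l. var c) = m}"
  by (rule finite_subset[OF _ finite_lists_length_eq[of "Poly_Mapping.keys m" n]])
    (auto simp: keys_sum_list_var simp del: One_nat_def)

lemma list_series_cong:
  "(\<And>l. length l = n \<Longrightarrow> v l = w l) \<Longrightarrow> list_series n v = list_series n w"
  unfolding list_series_def by (rule mps_eqI) (auto simp: mps_coeff_mps_sum intro!: sum.cong)

text \<open>Multiplication becomes concatenation: every word of length \<open>m + n\<close> is cut
  uniquely after its first \<open>m\<close> letters.\<close>

lemma list_series_times:
  "list_series m v * list_series n w = list_series (m + n) (\<lambda>l. v (take m l) * w (drop m l))"
proof -
  have "list_series m v * list_series n w = mps_sum ({l. length l = m} \<times> {l. length l = n})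
    (\<lambda>(k, l). v k * w l) (\<lambda>(k, l). (\<Sum>c\<leftarrow>k. var c) + (\<Sum>c\<leftarrow>l. var c))"
    unfolding list_series_def by (rule mps_sum_times; rule finite_list_fibre)
  also have "\<dots> = list_series (m + n) (\<lambda>l. v (take m l) * w (drop m l))"
    unfolding list_series_def
  proof (rule mps_sum_reindex)
    show "bij_betw (\<lambda>(k, l). k @ l) ({l. length l = m} \<times> {l. length l = n}) {l. length l = m + n}"
      by (rule bij_betw_byWitness[where f' = "\<lambda>l. (take m l, drop m l)"]) auto
  qed auto
  finally show ?thesis .
qed

lemma list_series_0: "list_series 0 w = mps_const (w [])"
proof (rule mps_eqI)
  fix m
  have "{l \<in> {l. length l = 0}. (\<Sum>c\<leftarrow>l. var c) = m} = (if m = 0 then {[]} else {})"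
    by auto
  then show "mps_coeff (list_series 0 w) m = mps_coeff (mps_const (w [])) m"
    by (simp add: list_series_def mps_coeff_mps_sum mps_const.rep_eq)
qed

text \<open>Each finite set of indices is listed once in increasing order.\<close>

lemma elem_sym_eq_list_series:
  "elem_sym n = list_series n (\<lambda>l. if sorted_wrt (<) l then 1 else 0)"
proof -
  have "mps_sum {l \<in> {l. length l = n}. sorted_wrt (<) l} (\<lambda>_. 1 :: 'a) (\<lambda>l. \<Sum>c\<leftarrow>l. var c) = elem_sym n"
    unfolding elem_sym_def
  proof (rule mps_sum_reindex)
    show "bij_betw (set :: nat list \<Rightarrow> nat set) {l \<in> {l. length l = n}. sorted_wrt (<) l} {S. finite S \<and> card S = n}"
      by (rule bij_betw_byWitness[where f' = sorted_list_of_set])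
        (auto simp: strict_sorted_iff distinct_card sorted_list_of_set.idem_if_sorted_distinct)
  qed (auto simp: strict_sorted_iff sum_list_distinct_conv_sum_set)
  then show ?thesis
    unfolding list_series_def mps_sum_filter[OF finite_list_fibre] by (rule sym)
qed

lemma asc_weight_cong:
  "(\<And>x y. (x, y) \<in> D \<Longrightarrow> \<kappa> x = \<kappa>' x \<and> \<kappa> y = \<kappa>' y) \<Longrightarrow> asc_weight D \<kappa> = asc_weight D \<kappa>'"
  unfolding asc_weight_def by (rule prod.cong) auto

text \<open>A colouring is read as the word of its colours. Vertices are counted from 1 and list
  positions from 0, hence \<open>i - 1\<close>.\<close>

lemma graph_LLT_eq_list_series:
  assumes "D \<subseteq> {1..n} \<times> {1..n}"
  shows "graph_LLT n D = list_series n (\<lambda>l. asc_weight D (\<lambda>i. l ! (i - 1)))"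
  unfolding graph_LLT_def list_series_def
proof (rule mps_sum_reindex)
  show "bij_betw (\<lambda>\<kappa>. map \<kappa> [1..<Suc n]) (colourings n) {l. length l = n}"
  proof (rule bij_betw_byWitness[where f' = "\<lambda>l. \<lambda>i\<in>{1..n}. l ! (i - 1)"])
    show "\<forall>\<kappa>\<in>colourings n. (\<lambda>i\<in>{1..n}. map \<kappa> [1..<Suc n] ! (i - 1)) = \<kappa>"
      by (auto simp: colourings_def fun_eq_iff PiE_def extensional_def simp del: upt_Suc)
    show "\<forall>l\<in>{l. length l = n}. map (\<lambda>i\<in>{1..n}. l ! (i - 1)) [1..<Suc n] = l"
      by (auto simp: list_eq_iff_nth_eq simp del: upt_Suc)
  qed (auto simp: colourings_def)
next
  fix \<kappa>
  show "asc_weight D \<kappa> = asc_weight D (\<lambda>i. map \<kappa> [1..<Suc n] ! (i - 1))"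
  proof (rule asc_weight_cong)
    fix x y assume "(x, y) \<in> D"
    with assms have "x \<in> {1..n}" "y \<in> {1..n}" by auto
    then have "x - 1 < n" "1 + (x - 1) = x" "y - 1 < n" "1 + (y - 1) = y" by auto
    then show "\<kappa> x = map \<kappa> [1..<Suc n] ! (x - 1) \<and> \<kappa> y = map \<kappa> [1..<Suc n] ! (y - 1)"
      by (simp del: upt_Suc)
  qed
  show "(\<Sum>i\<in>{1..n}. var (\<kappa> i)) = (\<Sum>c\<leftarrow>map \<kappa> [1..<Suc n]. var c)"
    by (simp add: sum_list_distinct_conv_sum_set o_def atLeastLessThanSuc_atLeastAtMost del: upt_Suc)
qed

section \<open>Multiplicativity of the LLT polynomials\<close>

lemma E_steps_shift: "E_steps (k + i) (l + j) P = map_prod ((+) k) ((+) l) ` E_steps i j P"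
  by (induction i j P rule: E_steps.induct) (auto simp flip: add_Suc_right)

lemma cells_shift: "cells (map_prod ((+) k) ((+) k) ` S) = map_prod ((+) k) ((+) k) ` cells S"
proof (intro set_eqI iffI)
  fix p assume "p \<in> cells (map_prod ((+) k) ((+) k) ` S)"
  then obtain x h y where "p = (k + x, y)" "(x, h) \<in> S" "k + x < y" "y \<le> k + h"
    by (auto simp: cells_def)
  then have "p = map_prod ((+) k) ((+) k) (x, y - k)" "(x, y - k) \<in> cells S"
    by (auto simp: cells_iff)
  then show "p \<in> map_prod ((+) k) ((+) k) ` cells S" by blast
next
  fix p assume "p \<in> map_prod ((+) k) ((+) k) ` cells S"
  then obtain x y h where p: "p = (k + x, k + y)" "x < y" "(x, h) \<in> S" "y \<le> h"
    by (auto simp: cells_def)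
  then have mem: "(k + x, k + h) \<in> map_prod ((+) k) ((+) k) ` S"
    by force
  show "p \<in> cells (map_prod ((+) k) ((+) k) ` S)"
    unfolding p(1) cells_iff
  proof (intro conjI exI)
    show "(k + x, k + h) \<in> map_prod ((+) k) ((+) k) ` S" by (rule mem)
  qed (use p in simp_all)
qed

lemma cells_E_steps_subset: "cells (E_steps 0 0 P) \<subseteq> {1..count_list P N} \<times> {1..count_list P N}"
  using E_steps_bounds[of _ _ 0 0 P] by (fastforce simp: cells_def)

lemma LLT_eq_list_series:
  "LLT P = list_series (count_list P N) (\<lambda>l. asc_weight (cells (E_steps 0 0 P)) (\<lambda>i. l ! (i - 1)))"
  by (simp only: LLT_eq_graph_LLT graph_edges_eq_cells path_size_def
      graph_LLT_eq_list_series[OF cells_E_steps_subset])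

text \<open>Since \<open>P\<close> ends at \<open>(n, n)\<close>, the cells of \<open>Q\<close> are
  translated along the diagonal and no edge joins the two blocks of vertices. The weight of a word
  factors at position \<open>n\<close>.\<close>

lemma multiplicative_LLT: "multiplicative LLT"
  unfolding multiplicative_def
proof (intro ballI)
  fix P Q assume "P \<in> DYCK" "Q \<in> DYCK"
  define n where "n = count_list P N"
  define D1 where "D1 = cells (E_steps 0 0 P)"
  define D2 where "D2 = cells (E_steps 0 0 Q)"
  have n: "count_list P E = n"
    using \<open>P \<in> DYCK\<close> by (simp add: DYCK_def n_def)
  have D: "cells (E_steps 0 0 (P @ Q)) = D1 \<union> map_prod ((+) n) ((+) n) ` D2"
    using E_steps_shift[of n 0 n 0 Q]
    by (simp add: E_steps_append n n_def[symmetric] cells_Un cells_shift D1_def D2_def)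
  have D1: "D1 \<subseteq> {1..n} \<times> {1..n}" and D2: "D2 \<subseteq> {1..count_list Q N} \<times> {1..count_list Q N}"
    unfolding D1_def D2_def n_def by (rule cells_E_steps_subset)+
  then have fin: "finite D1" "finite D2"
    by (auto intro: finite_subset)
  have weight: "asc_weight (D1 \<union> map_prod ((+) n) ((+) n) ` D2) (\<lambda>i. l ! (i - 1)) =
    asc_weight D1 (\<lambda>i. take n l ! (i - 1)) * asc_weight D2 (\<lambda>i. drop n l ! (i - 1))"
    if "length l = n + count_list Q N" for l
  proof -
    have "asc_weight (D1 \<union> map_prod ((+) n) ((+) n) ` D2) (\<lambda>i. l ! (i - 1)) =
      asc_weight D1 (\<lambda>i. l ! (i - 1)) * asc_weight (map_prod ((+) n) ((+) n) ` D2) (\<lambda>i. l ! (i - 1))"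
      unfolding asc_weight_def
    proof (rule prod.union_disjoint)
      show "D1 \<inter> map_prod ((+) n) ((+) n) ` D2 = {}"
        using D1 D2 by fastforce
    qed (use fin in auto)
    also have "asc_weight D1 (\<lambda>i. l ! (i - 1)) = asc_weight D1 (\<lambda>i. take n l ! (i - 1))"
    proof (rule asc_weight_cong)
      fix x y assume "(x, y) \<in> D1"
      with D1 have "x \<in> {1..n}" "y \<in> {1..n}" by auto
      then show "l ! (x - 1) = take n l ! (x - 1) \<and> l ! (y - 1) = take n l ! (y - 1)"
        by auto
    qed
    also have "asc_weight (map_prod ((+) n) ((+) n) ` D2) (\<lambda>i. l ! (i - 1)) =
      asc_weight D2 (\<lambda>i. l ! (n + i - 1))"
      unfolding asc_weight_def
      by (subst prod.reindex) (auto simp: inj_on_def case_prod_beta)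
    also have "\<dots> = asc_weight D2 (\<lambda>i. drop n l ! (i - 1))"
    proof (rule asc_weight_cong)
      fix x y assume "(x, y) \<in> D2"
      with D2 have "x \<in> {1..count_list Q N}" "y \<in> {1..count_list Q N}" by auto
      then show "l ! (n + x - 1) = drop n l ! (x - 1) \<and> l ! (n + y - 1) = drop n l ! (y - 1)"
        using that by auto
    qed
    finally show ?thesis .
  qed
  have "LLT (P @ Q) = list_series (n + count_list Q N)
    (\<lambda>l. asc_weight (D1 \<union> map_prod ((+) n) ((+) n) ` D2) (\<lambda>i. l ! (i - 1)))"
    by (simp only: LLT_eq_list_series D count_list_append n_def)
  also have "\<dots> = list_series (n + count_list Q N)
    (\<lambda>l. asc_weight D1 (\<lambda>i. take n l ! (i - 1)) * asc_weight D2 (\<lambda>i. drop n l ! (i - 1)))"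
    by (rule list_series_cong) (rule weight)
  also have "\<dots> = LLT P * LLT Q"
    by (simp only: LLT_eq_list_series list_series_times n_def D1_def D2_def)
  finally show "LLT (P @ Q) = LLT P * LLT Q" .
qed

section \<open>Words weighted by consecutive ascents\<close>

fun chain_weight :: "nat list \<Rightarrow> K" where
  "chain_weight (x # y # l) = (if x < y then q else 1) * chain_weight (y # l)"
| "chain_weight l = 1"

text \<open>In this form the weight is the product over the edges of the graph joining consecutive
  vertices.\<close>

lemma chain_weight_eq_prod:
  "chain_weight l = (\<Prod>i<length l - 1. if l ! i < l ! Suc i then q else 1)"
  by (induction l rule: chain_weight.induct) (simp_all add: prod.lessThan_Suc_shift del: prod.lessThan_Suc)

text \<open>For a word starting with \<open>x\<close>, \<open>y\<close>, the term
  \<open>j = 1\<close> is the weight of the word without \<open>x\<close>. The other terms occur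
  only if \<open>x < y\<close> and add up to \<open>q - 1\<close> times the same weight, by the
  expansion of the shorter word. The total factor is \<open>q\<close> or 1.\<close>

lemma chain_weight_expansion:
  "l \<noteq> [] \<Longrightarrow> chain_weight l =
    (\<Sum>j=1..length l. (q - 1) ^ (j - 1) *
      ((if sorted_wrt (<) (take j l) then 1 else 0) * chain_weight (drop j l)))"
proof (induction l rule: chain_weight.induct)
  case (1 x y l)
  let ?f = "\<lambda>j. (if sorted_wrt (<) (take j (y # l)) then 1 else 0) * chain_weight (drop j (y # l))"
  have sorted: "sorted_wrt (<) (x # take j (y # l)) \<longleftrightarrow> x < y \<and> sorted_wrt (<) (take j (y # l))"
    if "j \<ge> 1" for j
    using that by (cases j) (auto dest: order.strict_trans)
  have "(\<Sum>j=1..length (x # y # l). (q - 1) ^ (j - 1) *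
      ((if sorted_wrt (<) (take j (x # y # l)) then 1 else 0) * chain_weight (drop j (x # y # l)))) =
    chain_weight (y # l) + (\<Sum>j=1..length (y # l). (q - 1) ^ j *
      ((if sorted_wrt (<) (x # take j (y # l)) then 1 else 0) * chain_weight (drop j (y # l))))"
    by (subst sum.atLeast_Suc_atMost) (simp_all add: sum.shift_bounds_cl_Suc_ivl del: sum.cl_ivl_Suc)
  also have "(\<Sum>j=1..length (y # l). (q - 1) ^ j *
      ((if sorted_wrt (<) (x # take j (y # l)) then 1 else 0) * chain_weight (drop j (y # l)))) =
    (\<Sum>j=1..length (y # l). (if x < y then q - 1 else 0) * ((q - 1) ^ (j - 1) * ?f j))"
  proof (rule sum.cong[OF refl])
    fix j assume "j \<in> {1..length (y # l)}"
    then have "j \<ge> 1" by simp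
    then have "(q - 1) ^ j = (q - 1) * (q - 1) ^ (j - 1)"
      by (cases j) auto
    then show "(q - 1) ^ j *
        ((if sorted_wrt (<) (x # take j (y # l)) then 1 else 0) * chain_weight (drop j (y # l))) =
      (if x < y then q - 1 else 0) * ((q - 1) ^ (j - 1) * ?f j)"
      by (simp only: sorted[OF \<open>j \<ge> 1\<close>]) simp
  qed
  also have "\<dots> = (if x < y then q - 1 else 0) * chain_weight (y # l)"
    unfolding sum_distrib_left[symmetric] 1(1)[OF list.distinct(2), symmetric] ..
  finally show ?case
    by (simp add: algebra_simps)
qed auto

text \<open>Summed over all words, the strictly increasing prefix of length \<open>j\<close> becomes
  \<open>elem_sym j\<close> and the rest is again weighted by consecutive ascents.\<close>

lemma list_series_chain_weight_rec:
  assumes "n > 0"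
  shows "list_series n chain_weight =
    (\<Sum>j=1..n. mps_const ((q - 1) ^ (j - 1)) * (elem_sym j * list_series (n - j) chain_weight))"
proof -
  have "(\<Sum>j=1..n. mps_const ((q - 1) ^ (j - 1)) * (elem_sym j * list_series (n - j) chain_weight)) =
    (\<Sum>j=1..n. mps_const ((q - 1) ^ (j - 1)) * list_series n
      (\<lambda>l. (if sorted_wrt (<) (take j l) then 1 else 0) * chain_weight (drop j l)))"
    by (rule sum.cong) (simp_all add: elem_sym_eq_list_series list_series_times)
  also have "\<dots> = list_series n (\<lambda>l. \<Sum>j=1..n. (q - 1) ^ (j - 1) *
      ((if sorted_wrt (<) (take j l) then 1 else 0) * chain_weight (drop j l)))"
    unfolding list_series_def mps_const_times_sum sum_mps_sum ..
  also have "\<dots> = list_series n chain_weight"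
    using assms by (intro list_series_cong) (subst chain_weight_expansion; auto)
  finally show ?thesis ..
qed

lemma mps_const_mult: "mps_const (a * b) = mps_const a * mps_const (b :: 'a::comm_ring_1)"
  by (rule mps_eqI) (simp add: mps_coeff_const_times mps_const.rep_eq)

text \<open>The first part \<open>j\<close> of a composition is split off, together with
  \<open>j - 1\<close> of the factors \<open>c\<close>.\<close>

lemma sum_compositions_rec:
  fixes c :: K
  assumes "n > 0"
  shows "(\<Sum>\<alpha>\<in>compositions n. mps_const (c ^ (n - length \<alpha>)) * elem_sym_list \<alpha>) =
    (\<Sum>j=1..n. mps_const (c ^ (j - 1)) * (elem_sym j *
      (\<Sum>\<alpha>\<in>compositions (n - j). mps_const (c ^ (n - j - length \<alpha>)) * elem_sym_list \<alpha>)))"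
proof -
  have "(\<Sum>\<alpha>\<in>compositions n. mps_const (c ^ (n - length \<alpha>)) * elem_sym_list \<alpha>) =
    (\<Sum>(j, \<alpha>)\<in>Sigma {1..n} (\<lambda>j. compositions (n - j)).
      mps_const (c ^ (j - 1)) * (elem_sym j * (mps_const (c ^ (n - j - length \<alpha>)) * elem_sym_list \<alpha>)))"
  proof (rule sum.reindex_bij_witness[where i = "\<lambda>(j, \<alpha>). j # \<alpha>" and j = "\<lambda>\<alpha>. (hd \<alpha>, tl \<alpha>)"])
    fix \<alpha> assume \<alpha>: "\<alpha> \<in> compositions n"
    then obtain j \<beta> where j: "\<alpha> = j # \<beta>"
      using assms by (cases \<alpha>) (auto simp: compositions_def)
    then have \<beta>: "j \<ge> 1" "j \<le> n" "\<beta> \<in> compositions (n - j)"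
      using \<alpha> by (auto simp: compositions_def)
    then show "(case (hd \<alpha>, tl \<alpha>) of (j, \<alpha>) \<Rightarrow> j # \<alpha>) = \<alpha>"
      "(hd \<alpha>, tl \<alpha>) \<in> Sigma {1..n} (\<lambda>j. compositions (n - j))"
      using j by auto
    \<comment> \<open>Truncated subtraction is exact here because a composition has at most as many
      parts as its size.\<close>
    have "n - length \<alpha> = (j - 1) + (n - j - length \<beta>)"
      using \<beta> length_composition_le[OF \<beta>(3)] j by simp
    then show "(case (hd \<alpha>, tl \<alpha>) of (j, \<alpha>) \<Rightarrow> mps_const (c ^ (j - 1)) *
        (elem_sym j * (mps_const (c ^ (n - j - length \<alpha>)) * elem_sym_list \<alpha>))) =
      mps_const (c ^ (n - length \<alpha>)) * elem_sym_list \<alpha>"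
      using j by (simp add: power_add mps_const_mult elem_sym_list_def mult_ac)
  qed (auto simp: compositions_def)
  also have "\<dots> = (\<Sum>j=1..n. \<Sum>\<alpha>\<in>compositions (n - j).
      mps_const (c ^ (j - 1)) * (elem_sym j * (mps_const (c ^ (n - j - length \<alpha>)) * elem_sym_list \<alpha>)))"
    by (rule sum.Sigma[symmetric]) auto
  finally show ?thesis
    by (simp add: sum_distrib_left)
qed

text \<open>Both sides satisfy the same recursion, with the length of the increasing prefix in the
  role of the first part of the composition.\<close>

lemma list_series_chain_weight:
  "list_series n chain_weight =
    (\<Sum>\<alpha>\<in>compositions n. mps_const ((q - 1) ^ (n - length \<alpha>)) * elem_sym_list \<alpha>)"
proof (induction n rule: less_induct)
  case (less n)
  show ?case
  proof (cases "n = 0")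
    case True
    have "compositions 0 = {[]}"
      by (auto simp: compositions_def) (metis list.set_intros(1) list.exhaust less_numeral_extra(3))
    then show ?thesis
      using True mps_const_mult[of 1 1]
      by (simp add: list_series_0 elem_sym_list_def)
  next
    case False
    then show ?thesis
      using less by (subst list_series_chain_weight_rec, simp, subst sum_compositions_rec, simp)
        (auto intro!: sum.cong)
  qed
qed

lemma E_steps_staircase:
  "E_steps i j (concat (replicate k [N, E])) = (\<lambda>t. (i + Suc t, j + Suc t)) ` {..<k}"
proof (induction k arbitrary: i j)
  case (Suc k)
  show ?case
    by (simp add: Suc lessThan_Suc_eq_insert_0 image_image)
qed simp

lemma initial_values_LLT: "initial_values LLT"
  unfolding initial_values_def
proof
  fix k
  let ?P = "[N] @ concat (replicate k [N, E]) @ [E]"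
  have counts: "count_list (concat (replicate k [N, E])) s = k" for s
    by (induction k) (cases s; simp)+
  \<comment> \<open>Each inner east step lies one unit above the diagonal cell of its column and
    gives one cell; the final east step gives none. The graph joins consecutive vertices
    only.\<close>
  have edges: "cells (E_steps 0 0 ?P) = (\<lambda>t. (Suc t, Suc (Suc t))) ` {..<k}"
  proof -
    have "{Suc t<..Suc (Suc t)} = {Suc (Suc t)}" for t
      by auto
    then show ?thesis
      by (simp add: E_steps_append E_steps_staircase counts cells_def) blast
  qed
  have size: "count_list ?P N = Suc k"
    by (simp add: counts)
  have weight: "asc_weight ((\<lambda>t. (Suc t, Suc (Suc t))) ` {..<k}) (\<lambda>i. l ! (i - 1)) = chain_weight l"
    if "length l = Suc k" for l
    using that by (simp add: asc_weight_def prod.reindex inj_on_def chain_weight_eq_prod)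
  have "LLT ?P = list_series (Suc k)
    (\<lambda>l. asc_weight ((\<lambda>t. (Suc t, Suc (Suc t))) ` {..<k}) (\<lambda>i. l ! (i - 1)))"
    by (simp only: LLT_eq_list_series edges size)
  also have "\<dots> = list_series (Suc k) chain_weight"
    by (rule list_series_cong) (rule weight)
  finally show "LLT ?P =
      (\<Sum>\<alpha>\<in>compositions (k + 1). mps_const ((q - 1) ^ (k + 1 - length \<alpha>)) * elem_sym_list \<alpha>)"
    by (simp add: list_series_chain_weight)
qed

theorem theorem3p5:
  shows "(LLT \<in> DYCK \<rightarrow> \<Lambda> \<and> initial_values LLT \<and> multiplicative LLT \<and> bounce_relations LLT) \<and>
    (\<forall>F. F \<in> DYCK \<rightarrow> \<Lambda> \<and> initial_values F \<and> multiplicative F \<and> bounce_relations F \<longrightarrow>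
      (\<forall>P\<in>DYCK. F P = LLT P))"
  using symmetric_of_relations[OF initial_values_LLT multiplicative_LLT bounce_relations_LLT]
    determined_by_relations[OF _ _ _ initial_values_LLT multiplicative_LLT bounce_relations_LLT]
    initial_values_LLT multiplicative_LLT bounce_relations_LLT
  by blast

end
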